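(* Let $p$ be any prime number and let $G$ be a finite non-abelian $p$-group of nilpotency class $2$. Then $G$ has a noninner automorphism $\varphi$ of order $p$ such that either $\varphi(x)=x$ for all $x\in\Phi(G)$, or $\varphi(x)=x$ for all $x\in\Omega_1(Z(G))$.
   Context: $\Phi(G)$ denotes the Frattini subgroup of $G$ (the intersection of all maximal subgroups of $G$). $Z(G)$ denotes the center of $G$. For a finite $p$-group $P$, $\Omega_1(P)$ denotes the subgroup generated by all elements $x\in P$ with $x^p=1$; thus $\Omega_1(Z(G))$ is the subgroup of all $z\in Z(G)$ with $z^p=1$. An automorphism of $G$ is noninner if it is not of the form $x\mapsto g^{-1}xg$ for any $g\in G$. The order of an automorphism is its order as an element of the group $\mathrm{Aut}(G)$. *)

theory Defs
  imports "HOL-Algebra.Algebra"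
begin

definition maximal_subgroup :: "'a set \<Rightarrow> ('a, 'b) monoid_scheme \<Rightarrow> bool" where
  "maximal_subgroup M G \<longleftrightarrow>
     subgroup M G \<and> M \<noteq> carrier G \<and>
     (\<forall>H. subgroup H G \<and> M \<subseteq> H \<longrightarrow> H = M \<or> H = carrier G)"

text \<open>Intersecting with the carrier makes the Frattini subgroup of a group without
  maximal subgroups the whole group.\<close>

definition frattini :: "('a, 'b) monoid_scheme \<Rightarrow> 'a set" where
  "frattini G = carrier G \<inter> \<Inter> {M. maximal_subgroup M G}"

definition center :: "('a, 'b) monoid_scheme \<Rightarrow> 'a set" where
  "center G = {z \<in> carrier G. \<forall>x \<in> carrier G. z \<otimes>\<^bsub>G\<^esub> x = x \<otimes>\<^bsub>G\<^esub> z}"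

definition Omega1 :: "nat \<Rightarrow> ('a, 'b) monoid_scheme \<Rightarrow> 'a set" where
  "Omega1 p P = generate P {x \<in> carrier P. x [^]\<^bsub>P\<^esub> p = \<one>\<^bsub>P\<^esub>}"

definition commutator_subgroup :: "('a, 'b) monoid_scheme \<Rightarrow> 'a set \<Rightarrow> 'a set \<Rightarrow> 'a set" where
  "commutator_subgroup G H K =
     generate G (\<Union>h \<in> H. \<Union>k \<in> K. {h \<otimes>\<^bsub>G\<^esub> k \<otimes>\<^bsub>G\<^esub> inv\<^bsub>G\<^esub> h \<otimes>\<^bsub>G\<^esub> inv\<^bsub>G\<^esub> k})"

text \<open>The index is shifted: \<open>lower_central G i\<close> is the term usually written
  \<open>\<gamma>\<close> with subscript \<open>i + 1\<close>.\<close>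

primrec lower_central :: "('a, 'b) monoid_scheme \<Rightarrow> nat \<Rightarrow> 'a set" where
  "lower_central G 0 = carrier G"
| "lower_central G (Suc i) = commutator_subgroup G (lower_central G i) (carrier G)"

definition has_nilpotency_class :: "('a, 'b) monoid_scheme \<Rightarrow> nat \<Rightarrow> bool" where
  "has_nilpotency_class G c \<longleftrightarrow>
     lower_central G c = {\<one>\<^bsub>G\<^esub>} \<and> (\<forall>i < c. lower_central G i \<noteq> {\<one>\<^bsub>G\<^esub>})"

text \<open>Inner automorphisms are restricted to the carrier so that they are elements of
  \<^const>\<open>AutoGroup\<close>, whose elements are extensional functions.\<close>

definition inner_auto :: "('a, 'b) monoid_scheme \<Rightarrow> ('a \<Rightarrow> 'a) set" where
  "inner_auto G = {\<lambda>x \<in> carrier G. inv\<^bsub>G\<^esub> g \<otimes>\<^bsub>G\<^esub> x \<otimes>\<^bsub>G\<^esub> g | g. g \<in> carrier G}"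

end

theory Submission
  imports Defs
begin

text \<open>
  The automorphism that is found fixes the whole centre \<open>Z\<close> elementwise, and
  \<open>Z\<close> contains \<open>\<Omega>\<^sub>1(Z)\<close>.  In class 2 the commutator \<open>cm x y\<close> is central and
  multiplicative in each argument, so an inner automorphism moves every element by a central factor,
  \<open>g \<mapsto> g (cm g u)\<close>.  There are two cases, according to whether \<open>Z\<close> is cyclic; both are
  phrased through powers of elements.

  If \<open>Z\<close> has two independent elements of order \<open>p\<close>, the automorphism is central
  (\<open>noninner_from_independent_elements\<close>).  Every \<open>g\<close> outside
  \<open>P = G\<^sup>pZ\<close> and every \<open>z \<in> Z\<close> of order \<open>p\<close> give an automorphism
  \<open>h \<mapsto> h z\<^sup>i\<close> with \<open>g \<mapsto> g z\<close>.  If all of these are inner, the subgroup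
  \<open>U\<close> of those \<open>u\<close> whose commutators lie in \<open>\<langle>z\<rangle>\<close> has its centralizer inside
  \<open>P\<close>.  Counting commuting pairs in \<open>G \<times> U\<close> in two ways gives
  \<open>|U| |C(U)| = |G| |Z|\<close>, and the fibres of \<open>(g, z) \<mapsto> g\<^sup>p z\<close> give
  \<open>|G| |Z| = |E| |P|\<close>, where \<open>E/Z\<close> is the \<open>p\<close>-torsion of \<open>G/Z\<close>.  As
  \<open>U \<subseteq> E\<close>, it follows that \<open>U = E\<close>.  Two independent choices of \<open>z\<close> then make
  all commutators with elements of \<open>E\<close> trivial, so \<open>E = Z\<close>, and \<open>G\<close> would be abelian.

  Otherwise, of any two central elements one is a power of the other
  (\<open>noninner_from_power_chain\<close>).  Then all commutators are powers of a single
  \<open>c = cm x y\<close>, of order \<open>n\<close> say, and \<open>x\<close> can be corrected by a power of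
  \<open>y\<close> so that \<open>x\<^sup>n\<close> is a power of \<open>c\<close> with exponent divisible by
  \<open>n choose 2\<close>.  If \<open>n \<noteq> 2\<close>, this is a \<open>p\<close>-th power in \<open>Z\<close>, and some
  noncentral \<open>w = x\<^bsup>n/p\<^esup> z\<close> with \<open>z\<close> central has order \<open>p\<close>; multiplying
  \<open>y\<close> by \<open>w\<close> while fixing the centralizer of \<open>x\<close> extends to an automorphism of order
  \<open>p\<close> (\<open>twisted_translation_automorphism\<close>).  If \<open>n = 2\<close>, then \<open>p = 2\<close>, and
  a noncentral square root \<open>w\<close> of \<open>c\<close> gives an involution with \<open>y \<mapsto> y w\<close>
  (\<open>involution_by_square_root\<close>).  Both are noninner, because they multiply an element by a
  noncentral factor.
\<close>

section \<open>Commutator calculus in class two\<close>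

lemma (in group) subgroup_center: "subgroup (center G) G"
proof
  show "center G \<subseteq> carrier G" "\<one> \<in> center G" by (auto simp: center_def)
next
  fix x y assume x: "x \<in> center G" and y: "y \<in> center G"
  have c: "x \<in> carrier G" "y \<in> carrier G" using x y by (auto simp: center_def)
  have "x \<otimes> y \<otimes> g = g \<otimes> (x \<otimes> y)" if g: "g \<in> carrier G" for g
  proof -
    have xg: "x \<otimes> g = g \<otimes> x" and yg: "y \<otimes> g = g \<otimes> y"
      using x y g unfolding center_def by blast+
    have "x \<otimes> y \<otimes> g = (x \<otimes> g) \<otimes> y" using c g by (simp add: yg m_assoc)
    also have "\<dots> = g \<otimes> (x \<otimes> y)" using c g by (simp add: xg m_assoc)
    finally show ?thesis .
  qed
  with c show "x \<otimes> y \<in> center G" unfolding center_def by blast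
next
  fix x assume x: "x \<in> center G"
  have c: "x \<in> carrier G" using x by (auto simp: center_def)
  have "inv x \<otimes> g = g \<otimes> inv x" if g: "g \<in> carrier G" for g
  proof -
    have "inv g \<otimes> x = x \<otimes> inv g" using x g inv_closed unfolding center_def by auto
    then have "inv (inv g \<otimes> x) = inv (x \<otimes> inv g)" by simp
    then show ?thesis using c g by (simp add: inv_mult_group)
  qed
  with c show "inv x \<in> center G" unfolding center_def by blast
qed

locale class_two_group = group G for G (structure) +
  assumes commutator_in_center:
    "\<lbrakk>x \<in> carrier G; y \<in> carrier G\<rbrakk> \<Longrightarrow> x \<otimes> y \<otimes> inv x \<otimes> inv y \<in> center G"
begin

definition cm :: "'a \<Rightarrow> 'a \<Rightarrow> 'a" where
  "cm x y = x \<otimes> y \<otimes> inv x \<otimes> inv y"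

lemma center_closed [simp, intro]: "z \<in> center G \<Longrightarrow> z \<in> carrier G"
  by (simp add: center_def)

lemma center_commutes: "\<lbrakk>z \<in> center G; x \<in> carrier G\<rbrakk> \<Longrightarrow> x \<otimes> z = z \<otimes> x"
  unfolding center_def by (metis (mono_tags, lifting) mem_Collect_eq)

lemma center_mult [simp, intro]: "\<lbrakk>x \<in> center G; y \<in> center G\<rbrakk> \<Longrightarrow> x \<otimes> y \<in> center G"
  by (rule subgroup.m_closed[OF subgroup_center])

lemma center_inv [simp, intro]: "x \<in> center G \<Longrightarrow> inv x \<in> center G"
  by (rule subgroup.m_inv_closed[OF subgroup_center])

lemma center_one [simp, intro]: "\<one> \<in> center G"
  by (rule subgroup.one_closed[OF subgroup_center])

lemma center_pow [simp, intro]: "x \<in> center G \<Longrightarrow> x [^] (n::nat) \<in> center G"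
  by (induction n) auto

lemma center_pull:
  assumes z: "z \<in> center G" and "x \<in> carrier G" "y \<in> carrier G"
  shows "x \<otimes> (z \<otimes> y) = z \<otimes> (x \<otimes> y)"
proof -
  have "x \<otimes> (z \<otimes> y) = (x \<otimes> z) \<otimes> y" using assms by (intro m_assoc[symmetric]) auto
  also have "\<dots> = (z \<otimes> x) \<otimes> y" using center_commutes[OF z assms(2)] by simp
  also have "\<dots> = z \<otimes> (x \<otimes> y)" using assms by (intro m_assoc) auto
  finally show ?thesis .
qed

lemma cm_center [simp, intro]:
  "\<lbrakk>x \<in> carrier G; y \<in> carrier G\<rbrakk> \<Longrightarrow> cm x y \<in> center G"
  unfolding cm_def by (rule commutator_in_center)

lemma cm_closed [simp, intro]:
  "\<lbrakk>x \<in> carrier G; y \<in> carrier G\<rbrakk> \<Longrightarrow> cm x y \<in> carrier G"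
  by (rule center_closed) (rule cm_center)

lemma mult_swap_cm:
  assumes "x \<in> carrier G" "y \<in> carrier G"
  shows "x \<otimes> y = cm x y \<otimes> (y \<otimes> x)"
proof -
  have "cm x y \<otimes> (y \<otimes> x) = x \<otimes> y \<otimes> (inv x \<otimes> (inv y \<otimes> (y \<otimes> x)))"
    using assms by (simp add: cm_def m_assoc)
  also have "inv y \<otimes> (y \<otimes> x) = x" using assms by (simp flip: m_assoc)
  finally show ?thesis using assms by simp
qed

lemma cm_eqI:
  assumes "x \<in> carrier G" "y \<in> carrier G" "c \<in> carrier G" "x \<otimes> y = c \<otimes> (y \<otimes> x)"
  shows "cm x y = c"
  using assms mult_swap_cm[of x y] by simp

lemma cm_eq_one_iff:
  assumes "x \<in> carrier G" "y \<in> carrier G"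
  shows "cm x y = \<one> \<longleftrightarrow> x \<otimes> y = y \<otimes> x"
proof
  assume "cm x y = \<one>" then show "x \<otimes> y = y \<otimes> x" using assms mult_swap_cm[of x y] by simp
next
  assume "x \<otimes> y = y \<otimes> x" then show "cm x y = \<one>" using assms by (intro cm_eqI) auto
qed

lemma cm_swap:
  assumes "x \<in> carrier G" "y \<in> carrier G"
  shows "cm y x = inv (cm x y)"
proof (rule cm_eqI)
  show "y \<otimes> x = inv cm x y \<otimes> (x \<otimes> y)"
    using mult_swap_cm[OF assms] assms inv_solve_left[of "y \<otimes> x" "cm x y" "x \<otimes> y"] by simp
qed (use assms in auto)

lemma cm_mult_left:
  assumes "x \<in> carrier G" "y \<in> carrier G" "g \<in> carrier G"
  shows "cm (x \<otimes> y) g = cm x g \<otimes> cm y g"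
proof (rule cm_eqI)
  have "x \<otimes> y \<otimes> g = x \<otimes> (cm y g \<otimes> (g \<otimes> y))"
    using assms mult_swap_cm[of y g] by (simp add: m_assoc)
  also have "\<dots> = cm y g \<otimes> ((x \<otimes> g) \<otimes> y)"
    using assms by (simp add: center_pull[of "cm y g" x "g \<otimes> y"] m_assoc)
  also have "\<dots> = cm y g \<otimes> ((cm x g \<otimes> (g \<otimes> x)) \<otimes> y)"
    using assms mult_swap_cm[of x g] by simp
  also have "\<dots> = (cm y g \<otimes> cm x g) \<otimes> (g \<otimes> (x \<otimes> y))"
    using assms by (simp add: m_assoc)
  also have "cm y g \<otimes> cm x g = cm x g \<otimes> cm y g"
    using assms by (intro center_commutes) auto
  finally show "x \<otimes> y \<otimes> g = cm x g \<otimes> cm y g \<otimes> (g \<otimes> (x \<otimes> y))" .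
qed (use assms in auto)

lemma cm_mult_right:
  assumes "x \<in> carrier G" "y \<in> carrier G" "g \<in> carrier G"
  shows "cm g (x \<otimes> y) = cm g x \<otimes> cm g y"
proof -
  have "cm g (x \<otimes> y) = inv (cm x g \<otimes> cm y g)"
    using assms by (simp add: cm_swap[of "x \<otimes> y" g] cm_mult_left)
  also have "\<dots> = cm g y \<otimes> cm g x"
    using assms by (simp add: inv_mult_group cm_swap[of x g] cm_swap[of y g])
  also have "\<dots> = cm g x \<otimes> cm g y" using assms by (intro center_commutes) auto
  finally show ?thesis .
qed

lemma cm_central_left [simp]: "\<lbrakk>z \<in> center G; x \<in> carrier G\<rbrakk> \<Longrightarrow> cm z x = \<one>"
  by (subst cm_eq_one_iff) (auto intro: center_commutes[symmetric])

lemma cm_central_right [simp]: "\<lbrakk>z \<in> center G; x \<in> carrier G\<rbrakk> \<Longrightarrow> cm x z = \<one>"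
  by (subst cm_eq_one_iff) (auto intro: center_commutes)

lemma cm_self [simp]: "x \<in> carrier G \<Longrightarrow> cm x x = \<one>"
  by (simp add: cm_eq_one_iff)

lemma cm_pow_left:
  "\<lbrakk>x \<in> carrier G; g \<in> carrier G\<rbrakk> \<Longrightarrow> cm (x [^] (n::nat)) g = cm x g [^] n"
  by (induction n) (simp_all add: cm_mult_left)

lemma cm_pow_right:
  "\<lbrakk>x \<in> carrier G; g \<in> carrier G\<rbrakk> \<Longrightarrow> cm g (x [^] (n::nat)) = cm g x [^] n"
  by (induction n) (simp_all add: cm_mult_right)

lemma mem_center_iff:
  "x \<in> center G \<longleftrightarrow> x \<in> carrier G \<and> (\<forall>g\<in>carrier G. cm x g = \<one>)"
proof -
  have "x \<in> center G \<longleftrightarrow> x \<in> carrier G \<and> (\<forall>g\<in>carrier G. x \<otimes> g = g \<otimes> x)"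
    by (simp only: center_def mem_Collect_eq)
  then show ?thesis using cm_eq_one_iff by blast
qed

text \<open>
  Collecting \<open>(x y)\<^sup>n\<close> as \<open>x\<^sup>n y\<^sup>n\<close> moves each \<open>x\<close> past all earlier \<open>y\<close>'s, which costs one
  commutator for each of the \<open>n choose 2\<close> pairs.  This binomial coefficient is what separates
  the case of commutators of order 2 from all others below.
\<close>

lemma mult_pow:
  assumes "x \<in> carrier G" "y \<in> carrier G"
  shows "(x \<otimes> y) [^] (n::nat) = cm y x [^] (n choose 2) \<otimes> (x [^] n \<otimes> y [^] n)"
proof (induction n)
  case (Suc n)
  let ?c = "cm y x [^] (n choose 2)"
  have yx: "y [^] n \<otimes> x = cm y x [^] n \<otimes> (x \<otimes> y [^] n)"
    using assms mult_swap_cm[of "y [^] n" x] by (simp add: cm_pow_left)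
  have "(x \<otimes> y) [^] Suc n = ?c \<otimes> (x [^] n \<otimes> ((y [^] n \<otimes> x) \<otimes> y))"
    using assms by (simp add: Suc m_assoc)
  also have "\<dots> = ?c \<otimes> (cm y x [^] n \<otimes> (x [^] n \<otimes> (x \<otimes> y [^] n \<otimes> y)))"
    using assms by (simp add: yx m_assoc center_pull[of "cm y x [^] n" "x [^] n"])
  also have "\<dots> = (?c \<otimes> cm y x [^] n) \<otimes> (x [^] Suc n \<otimes> y [^] Suc n)"
    using assms by (simp add: m_assoc)
  also have "?c \<otimes> cm y x [^] n = cm y x [^] (Suc n choose 2)"
    using assms by (simp add: nat_pow_mult numeral_2_eq_2 add.commute)
  finally show ?case .
qed (use assms in \<open>simp add: numeral_2_eq_2\<close>)

lemma mult_pow_central: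
  assumes "x \<in> carrier G" "z \<in> center G"
  shows "(x \<otimes> z) [^] (n::nat) = x [^] n \<otimes> z [^] n"
  using mult_pow[of x z n] assms by simp

end

section \<open>Constructions of automorphisms\<close>

lemma (in group) automorphism_of_prime_order:
  assumes p: "Factorial_Ring.prime p"
    and hom: "\<phi> \<in> hom G G"
    and period: "\<And>g. g \<in> carrier G \<Longrightarrow> (\<phi> ^^ p) g = g"
    and moved: "a \<in> carrier G" "\<phi> a \<noteq> a"
  shows "restrict \<phi> (carrier G) \<in> carrier (AutoGroup G)"
    and "group.ord (AutoGroup G) (restrict \<phi> (carrier G)) = p"
proof -
  let ?S = "carrier G" and ?f = "restrict \<phi> (carrier G)" and ?A = "AutoGroup G"
  interpret A: group ?A by (rule AutoGroup)
  have closed: "\<phi> x \<in> ?S" if "x \<in> ?S" for x using hom that by (auto simp: hom_def)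
  have closed_pow: "(\<phi> ^^ k) x \<in> ?S" if "x \<in> ?S" for x k
    by (induction k) (use that closed in auto)
  obtain q where q: "p = Suc q" using prime_gt_0_nat[OF p] gr0_implies_Suc by blast
  have left: "(\<phi> ^^ q) (\<phi> x) = x" if "x \<in> ?S" for x
    using period[OF that] by (simp add: q funpow_swap1)
  have right: "\<phi> ((\<phi> ^^ q) x) = x" if "x \<in> ?S" for x
    using period[OF that] by (simp add: q)
  have "bij_betw \<phi> ?S ?S"
    by (rule bij_betw_byWitness[where f' = "\<phi> ^^ q"]) (use left right closed closed_pow in auto)
  then have "bij_betw ?f ?S ?S" by (subst bij_betw_cong[of ?S ?f \<phi>]) auto
  then have bij: "?f \<in> Bij ?S" by (auto simp: Bij_def)
  have "?f \<in> hom G G" using hom by (auto simp: hom_def)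
  with bij show in_A: "?f \<in> carrier ?A" by (simp add: AutoGroup_def auto_def)
  have sub: "x \<in> Bij ?S" if "x \<in> carrier ?A" for x
    using that by (simp add: AutoGroup_def auto_def)
  have pow: "?f [^]\<^bsub>?A\<^esub> (k::nat) = restrict (\<phi> ^^ k) ?S" for k
  proof (induction k)
    case 0
    then show ?case by (auto simp: AutoGroup_def BijGroup_def)
  next
    case (Suc k)
    have "?f [^]\<^bsub>?A\<^esub> Suc k = compose ?S (?f [^]\<^bsub>?A\<^esub> k) ?f"
      using bij sub[OF A.nat_pow_closed[OF in_A]] by (simp add: AutoGroup_def BijGroup_def)
    also have "\<dots> = restrict (\<phi> ^^ Suc k) ?S"
      unfolding Suc using closed by (auto simp: compose_def restrict_def funpow_swap1)
    finally show ?case .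
  qed
  have "?f [^]\<^bsub>?A\<^esub> p = \<one>\<^bsub>?A\<^esub>"
    unfolding pow using period by (auto simp: AutoGroup_def BijGroup_def restrict_def)
  then have "A.ord ?f dvd p" using in_A A.pow_eq_id by blast
  moreover have "?f a \<noteq> \<one>\<^bsub>?A\<^esub> a"
    using moved by (simp add: AutoGroup_def BijGroup_def)
  then have "?f \<noteq> \<one>\<^bsub>?A\<^esub>" by metis
  then have "A.ord ?f \<noteq> 1" using in_A A.ord_eq_1 by blast
  ultimately show "A.ord ?f = p" using p by (auto simp: prime_nat_iff)
qed

lemma (in group) pow_eq_imp_mod_ord_eq:
  assumes "x \<in> carrier G" "x [^] (i::nat) = x [^] (j::nat)"
  shows "i mod ord x = j mod ord x"
proof -
  have "int (ord x) dvd int j - int i"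
    using int_pow_eq[OF assms(1), of "int i" "int j"] assms(2) by (simp add: int_pow_int)
  then have "int j mod int (ord x) = int i mod int (ord x)" by (simp only: mod_eq_dvd_iff)
  then show ?thesis by (simp flip: of_nat_mod)
qed

context class_two_group begin

text \<open>
  The map is prescribed by \<open>a \<mapsto> a w\<close> and by fixing the kernel of \<open>h\<close>; with \<open>t\<close> the
  commutator of \<open>w\<close> and \<open>a\<close>, this forces \<open>(a w)\<^sup>i = a\<^sup>i w\<^sup>i t\<^bsup>i choose 2\<^esup>\<close>
  by \<open>mult_pow\<close>, hence the formula in the conclusion.  The exponent \<open>i\<close> is
  determined only modulo the order \<open>n\<close> of \<open>c\<close>, and the hypotheses on \<open>n\<close> make the correcting
  factor periodic with period \<open>n\<close>.  Two choices of \<open>h\<close> are of interest: \<open>cm x\<close>, and a quotient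
  map onto a group of order \<open>p\<close> with \<open>w\<close> central and \<open>t = \<one>\<close>.
\<close>

lemma twisted_translation_automorphism:
  fixes h :: "'a \<Rightarrow> 'c" and H :: "('c, 'd) monoid_scheme" and p :: nat
  assumes p: "Factorial_Ring.prime p"
    and H: "group H" and h: "h \<in> hom G H"
    and c: "c \<in> carrier H" "\<And>g. g \<in> carrier G \<Longrightarrow> \<exists>i::nat. h g = c [^]\<^bsub>H\<^esub> i"
    and n: "p dvd group.ord H c"
    and w: "w \<in> carrier G" "w [^] p = \<one>" "w \<noteq> \<one>"
    and t: "t \<in> center G" "t [^] p = \<one>" "t [^] (group.ord H c choose 2) = \<one>"
    and cm_w: "\<And>g i. \<lbrakk>g \<in> carrier G; h g = c [^]\<^bsub>H\<^esub> (i::nat)\<rbrakk> \<Longrightarrow> cm w g = t [^] i"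
    and hw: "h w = \<one>\<^bsub>H\<^esub>" and hz: "\<And>z. z \<in> center G \<Longrightarrow> h z = \<one>\<^bsub>H\<^esub>"
    and a: "a \<in> carrier G" "h a = c"
  obtains \<phi> where "\<phi> \<in> carrier (AutoGroup G)" "group.ord (AutoGroup G) \<phi> = p"
    "\<And>z. z \<in> center G \<Longrightarrow> \<phi> z = z"
    "\<And>g i. \<lbrakk>g \<in> carrier G; h g = c [^]\<^bsub>H\<^esub> (i::nat)\<rbrakk> \<Longrightarrow> \<phi> g = g \<otimes> (w [^] i \<otimes> t [^] (i choose 2))"
proof -
  interpret H: group H by (rule H)
  interpret h: group_hom G H h using h by unfold_locales
  define n where "n = H.ord c"
  define A where "A i = w [^] i \<otimes> t [^] (i choose 2)" for i :: nat
  have A_closed [simp]: "A i \<in> carrier G" for i using w t by (simp add: A_def)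
  have t_dvd: "t [^] k = \<one>" if "p dvd k" for k :: nat
    using that t by (auto simp: nat_pow_pow[symmetric])
  have w_dvd: "w [^] k = \<one>" if "p dvd k" for k :: nat
    using that w by (auto simp: nat_pow_pow[symmetric])
  have choose_add: "(i + j choose 2) = (i choose 2) + (j choose 2) + i * j" for i j :: nat
    by (induction j) (auto simp: numeral_2_eq_2)
  have A_add: "A (i + j) = t [^] (i * j) \<otimes> (A i \<otimes> A j)" for i j
  proof -
    have "A i \<otimes> A j = w [^] i \<otimes> (t [^] (i choose 2) \<otimes> (w [^] j \<otimes> t [^] (j choose 2)))"
      using w t by (simp add: A_def m_assoc)
    also have "\<dots> = t [^] (i choose 2) \<otimes> (w [^] (i + j) \<otimes> t [^] (j choose 2))"
      using w t center_pull[of "t [^] (i choose 2)" "w [^] i"] by (simp add: m_assoc nat_pow_mult[symmetric])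
    also have "w [^] (i + j) \<otimes> t [^] (j choose 2) = t [^] (j choose 2) \<otimes> w [^] (i + j)"
      using w t by (intro center_commutes) auto
    finally have "t [^] (i * j) \<otimes> (A i \<otimes> A j) = t [^] (i * j + ((i choose 2) + (j choose 2))) \<otimes> w [^] (i + j)"
      using w t by (simp add: m_assoc nat_pow_mult[symmetric])
    also have "\<dots> = w [^] (i + j) \<otimes> t [^] (i + j choose 2)"
      using w t center_commutes[of "t [^] (i + j choose 2)" "w [^] (i + j)"]
      by (simp add: choose_add ac_simps)
    finally show ?thesis by (simp add: A_def)
  qed
  have A_n: "A (i + n * k) = A i" for i k
  proof (induction k)
    case (Suc k)
    have "A (i + n * Suc k) = A ((i + n * k) + n)" by (simp add: ac_simps)
    also have "\<dots> = t [^] ((i + n * k) * n) \<otimes> (A (i + n * k) \<otimes> A n)" by (rule A_add)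
    also have "A n = \<one>" using t n w_dvd by (simp add: A_def n_def)
    also have "t [^] ((i + n * k) * n) = \<one>" using n by (intro t_dvd) (simp add: n_def)
    finally show ?case using Suc by simp
  qed simp
  have A_cong: "A i = A j" if ij: "c [^]\<^bsub>H\<^esub> i = c [^]\<^bsub>H\<^esub> j" for i j
  proof -
    have "i mod n = j mod n" using H.pow_eq_imp_mod_ord_eq[OF c(1) ij] by (simp add: n_def)
    then show ?thesis
      using A_n[of "i mod n" "i div n"] A_n[of "j mod n" "j div n"]
      by (metis mod_mult_div_eq mult.commute)
  qed
  \<comment> \<open>Any choice of exponent will do, by \<open>A_cong\<close>.\<close>
  define J where "J g = (SOME i::nat. h g = c [^]\<^bsub>H\<^esub> i)" for g
  have J: "h g = c [^]\<^bsub>H\<^esub> J g" if "g \<in> carrier G" for g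
    unfolding J_def using c(2)[OF that] by (rule someI_ex)
  define \<phi> where "\<phi> g = g \<otimes> A (J g)" for g
  have \<phi>_eq: "\<phi> g = g \<otimes> A i" if "g \<in> carrier G" "h g = c [^]\<^bsub>H\<^esub> i" for g i
    using A_cong[of "J g" i] J that by (simp add: \<phi>_def)
  have \<phi>_fix: "\<phi> g = g" if "g \<in> carrier G" "h g = \<one>\<^bsub>H\<^esub>" for g
    using \<phi>_eq[of g 0] that by (simp add: A_def numeral_2_eq_2)
  have hom: "\<phi> (g \<otimes> g') = \<phi> g \<otimes> \<phi> g'" if g: "g \<in> carrier G" "g' \<in> carrier G" for g g'
  proof -
    let ?i = "J g" and ?j = "J g'"
    have A_move: "A ?i \<otimes> g' = t [^] (?i * ?j) \<otimes> (g' \<otimes> A ?i)"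
    proof -
      have "cm (A ?i) g' = t [^] (?i * ?j)"
        using w t g cm_w[OF g(2) J[OF g(2)]]
        by (simp add: A_def cm_mult_left cm_pow_left nat_pow_pow mult.commute)
      then show ?thesis using mult_swap_cm[of "A ?i" g'] g by simp
    qed
    have "h (g \<otimes> g') = c [^]\<^bsub>H\<^esub> (?i + ?j)"
      using g c(1) J[OF g(1)] J[OF g(2)] h.hom_mult[OF g] by (simp add: H.nat_pow_mult)
    then have "\<phi> (g \<otimes> g') = g \<otimes> g' \<otimes> A (?i + ?j)" using g by (intro \<phi>_eq) auto
    also have "\<dots> = (g \<otimes> g') \<otimes> (t [^] (?i * ?j) \<otimes> (A ?i \<otimes> A ?j))" by (simp add: A_add)
    also have "\<dots> = t [^] (?i * ?j) \<otimes> (g \<otimes> (g' \<otimes> (A ?i \<otimes> A ?j)))"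
      using g t center_pull[of "t [^] (?i * ?j)" "g \<otimes> g'" "A ?i \<otimes> A ?j"] by (simp add: m_assoc)
    also have "\<dots> = g \<otimes> ((t [^] (?i * ?j) \<otimes> (g' \<otimes> A ?i)) \<otimes> A ?j)"
      using g t center_pull[of "t [^] (?i * ?j)" g "g' \<otimes> (A ?i \<otimes> A ?j)"] by (simp add: m_assoc)
    also have "\<dots> = g \<otimes> ((A ?i \<otimes> g') \<otimes> A ?j)" by (simp only: A_move)
    also have "\<dots> = \<phi> g \<otimes> \<phi> g'" using g by (simp add: \<phi>_def m_assoc)
    finally show ?thesis .
  qed
  have \<phi>_hom: "\<phi> \<in> hom G G" using hom by (auto simp: hom_def \<phi>_def)
  interpret \<phi>: group_hom G G \<phi> using \<phi>_hom by unfold_locales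
  have \<phi>_A: "\<phi> (A i) = A i" for i
    using w t hw hz[of t] by (intro \<phi>_fix) (simp_all add: A_def h.hom_nat_pow)
  have A_p: "A i [^] p = \<one>" for i
  proof -
    have "A i [^] p = w [^] (i * p) \<otimes> t [^] ((i choose 2) * p)"
      using w t by (simp add: A_def mult_pow_central nat_pow_pow)
    then show ?thesis by (simp add: w_dvd t_dvd)
  qed
  have pow: "(\<phi> ^^ k) g = g \<otimes> A (J g) [^] k" if "g \<in> carrier G" for g k
  proof (induction k)
    case (Suc k)
    have "(\<phi> ^^ Suc k) g = \<phi> g \<otimes> A (J g) [^] k"
      using that by (simp add: Suc \<phi>.hom_nat_pow \<phi>_A)
    also have "\<dots> = g \<otimes> A (J g) [^] Suc k"
      using that by (simp add: \<phi>_def m_assoc nat_pow_Suc2[symmetric] del: nat_pow_Suc)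
    finally show ?case .
  qed (use that in simp)
  have per: "(\<phi> ^^ p) g = g" if "g \<in> carrier G" for g
    using that by (simp add: pow A_p)
  have "\<phi> a = a \<otimes> w" using \<phi>_eq[of a 1] a c(1) w by (simp add: A_def numeral_2_eq_2)
  then have moved: "\<phi> a \<noteq> a" using a w by (simp add: l_cancel_one')
  show thesis
  proof (rule that)
    show "restrict \<phi> (carrier G) \<in> carrier (AutoGroup G)"
      "group.ord (AutoGroup G) (restrict \<phi> (carrier G)) = p"
      using automorphism_of_prime_order[OF p \<phi>_hom per a(1) moved] by auto
    show "restrict \<phi> (carrier G) z = z" if "z \<in> center G" for z
      using \<phi>_fix[of z] hz that by auto
    show "restrict \<phi> (carrier G) g = g \<otimes> (w [^] i \<otimes> t [^] (i choose 2))"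
      if "g \<in> carrier G" "h g = c [^]\<^bsub>H\<^esub> i" for g and i :: nat
      using \<phi>_eq[of g i] that by (simp add: A_def)
  qed
qed

lemma inner_auto_by_cm:
  assumes "\<phi> \<in> inner_auto G"
  obtains u where "u \<in> carrier G" "\<And>g. g \<in> carrier G \<Longrightarrow> \<phi> g = g \<otimes> cm g u"
proof -
  obtain u where u: "u \<in> carrier G" "\<phi> = (\<lambda>x\<in>carrier G. inv u \<otimes> x \<otimes> u)"
    using assms by (auto simp: inner_auto_def)
  have "\<phi> g = g \<otimes> cm g u" if g: "g \<in> carrier G" for g
  proof -
    have "g \<otimes> u = u \<otimes> (g \<otimes> cm g u)"
      using g u mult_swap_cm[of g u] center_commutes[of "cm g u" "u \<otimes> g"] by (simp add: m_assoc)
    then have "inv u \<otimes> (g \<otimes> u) = g \<otimes> cm g u" using g u by (simp add: inv_solve_left')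
    then show ?thesis using g u by (simp add: m_assoc)
  qed
  with u show thesis using that by blast
qed

text \<open>
  Inner automorphisms act trivially modulo the centre.
\<close>

lemma noninnerI:
  assumes "a \<in> carrier G" "w \<in> carrier G" "w \<notin> center G" "\<phi> a = a \<otimes> w"
  shows "\<phi> \<notin> inner_auto G"
proof
  assume "\<phi> \<in> inner_auto G"
  then obtain u where "u \<in> carrier G" "\<phi> a = a \<otimes> cm a u"
    using inner_auto_by_cm[of \<phi>] assms(1) by metis
  with assms have "w = cm a u" by simp
  with \<open>u \<in> carrier G\<close> assms show False by auto
qed

text \<open>
  Fixing the centralizer of \<open>w\<close> and sending \<open>y\<close> to \<open>y w\<close> is an automorphism because
  \<open>(y w)\<^sup>2 = y\<^sup>2 w\<^sup>2 (cm w y) = y\<^sup>2\<close>, but its square is multiplication of \<open>y\<close> by \<open>w\<^sup>2 = t\<close>, so its order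
  is 4.  Composing it with conjugation by \<open>y\<close>, which sends \<open>w\<close> to \<open>w t\<close>, cancels this factor.
\<close>

lemma involution_by_square_root:
  assumes t: "t \<in> center G" "t \<noteq> \<one>" "t \<otimes> t = \<one>"
    and cm_t: "\<And>x y. \<lbrakk>x \<in> carrier G; y \<in> carrier G\<rbrakk> \<Longrightarrow> cm x y = \<one> \<or> cm x y = t"
    and w: "w \<in> carrier G" "w \<notin> center G" "w \<otimes> w = t"
  obtains \<phi> where "\<phi> \<in> carrier (AutoGroup G)" "group.ord (AutoGroup G) \<phi> = 2"
    "\<phi> \<notin> inner_auto G" "\<And>z. z \<in> center G \<Longrightarrow> \<phi> z = z"
proof -
  obtain y where y: "y \<in> carrier G" "cm w y = t"
    using w(1,2) cm_t mem_center_iff by metis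
  define B where "B g = (if cm w g = \<one> then \<one> else w)" for g
  define \<phi> where "\<phi> g = g \<otimes> (cm g y \<otimes> B g)" for g
  have B_closed [simp]: "B g \<in> carrier G" for g using w by (simp add: B_def)
  have cm_sq: "cm x y \<otimes> cm x y = \<one>" if "x \<in> carrier G" "y \<in> carrier G" for x y
    using cm_t[OF that] t by auto
  have B_mult: "B (g \<otimes> g') = cm (B g) g' \<otimes> (B g \<otimes> B g')"
    if "g \<in> carrier G" "g' \<in> carrier G" for g g'
    using that w t cm_t[of w g] cm_t[of w g'] by (auto simp: B_def cm_mult_right)
  have hom: "\<phi> (g \<otimes> g') = \<phi> g \<otimes> \<phi> g'" if g: "g \<in> carrier G" "g' \<in> carrier G" for g g'
  proof -
    let ?c = "cm g y" and ?c' = "cm g' y"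
    have "\<phi> (g \<otimes> g') = (g \<otimes> g') \<otimes> ((?c \<otimes> ?c') \<otimes> (cm (B g) g' \<otimes> (B g \<otimes> B g')))"
      using g y by (simp add: \<phi>_def cm_mult_left B_mult)
    also have "\<dots> = (?c \<otimes> ?c') \<otimes> ((g \<otimes> g') \<otimes> (cm (B g) g' \<otimes> (B g \<otimes> B g')))"
      using g y by (intro center_pull) auto
    also have "\<dots> = (?c \<otimes> ?c') \<otimes> (g \<otimes> ((cm (B g) g' \<otimes> (g' \<otimes> B g)) \<otimes> B g'))"
      using g y center_pull[of "cm (B g) g'" g' "B g \<otimes> B g'"] by (simp add: m_assoc)
    also have "\<dots> = (?c \<otimes> ?c') \<otimes> (g \<otimes> ((B g \<otimes> g') \<otimes> B g'))"
      using g mult_swap_cm[of "B g" g'] by simp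
    also have "\<dots> = ?c \<otimes> (g \<otimes> (B g \<otimes> (?c' \<otimes> (g' \<otimes> B g'))))"
      using g y center_pull[of ?c' "g \<otimes> B g" "g' \<otimes> B g'"] by (simp add: m_assoc)
    also have "\<dots> = (?c \<otimes> (g \<otimes> B g)) \<otimes> (?c' \<otimes> (g' \<otimes> B g'))"
      using g y by (simp add: m_assoc)
    also have "\<dots> = \<phi> g \<otimes> \<phi> g'"
      using g y center_pull[of ?c g "B g"] center_pull[of ?c' g' "B g'"] by (simp add: \<phi>_def)
    finally show ?thesis .
  qed
  have \<phi>_hom: "\<phi> \<in> hom G G" using hom y by (auto simp: hom_def \<phi>_def)
  have \<phi>_center: "\<phi> z = z" if "z \<in> center G" for z
    using that w y by (simp add: \<phi>_def B_def)
  have \<phi>_B: "\<phi> (B g) = cm (B g) y \<otimes> B g" for g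
    using w y t center_commutes[of t w] by (auto simp: \<phi>_def B_def)
  have per: "(\<phi> ^^ 2) g = g" if g: "g \<in> carrier G" for g
  proof -
    let ?c = "cm g y"
    have "\<phi> (\<phi> g) = \<phi> g \<otimes> (\<phi> ?c \<otimes> \<phi> (B g))"
      using g y hom by (simp add: \<phi>_def[of g])
    also have "\<dots> = (g \<otimes> (?c \<otimes> B g)) \<otimes> (?c \<otimes> (cm (B g) y \<otimes> B g))"
      using g y by (simp add: \<phi>_B \<phi>_center) (simp add: \<phi>_def)
    also have "\<dots> = g \<otimes> (?c \<otimes> (B g \<otimes> (?c \<otimes> (cm (B g) y \<otimes> B g))))"
      using g y by (simp add: m_assoc)
    also have "B g \<otimes> (?c \<otimes> (cm (B g) y \<otimes> B g)) = ?c \<otimes> (B g \<otimes> (cm (B g) y \<otimes> B g))"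
      using g y by (intro center_pull) auto
    also have "B g \<otimes> (cm (B g) y \<otimes> B g) = \<one>"
      using y t w center_pull[of t w w] by (auto simp: B_def)
    finally have "\<phi> (\<phi> g) = g \<otimes> (?c \<otimes> ?c)" using g y by (simp add: m_assoc)
    then show ?thesis using g y cm_sq by (simp add: numeral_2_eq_2)
  qed
  have "\<phi> y = y \<otimes> w" using y w t by (simp add: \<phi>_def B_def)
  moreover have "w \<noteq> \<one>" using w by auto
  ultimately have moved: "\<phi> y \<noteq> y" using y w by (simp add: l_cancel_one')
  show thesis
  proof (rule that)
    show "restrict \<phi> (carrier G) \<in> carrier (AutoGroup G)"
      "group.ord (AutoGroup G) (restrict \<phi> (carrier G)) = 2"
      using automorphism_of_prime_order[OF two_is_prime_nat \<phi>_hom per y(1) moved] by auto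
    show "restrict \<phi> (carrier G) z = z" if "z \<in> center G" for z
      using \<phi>_center that by auto
    show "restrict \<phi> (carrier G) \<notin> inner_auto G"
      using \<open>\<phi> y = y \<otimes> w\<close> y w by (intro noninnerI[of y w]) auto
  qed
qed

end

section \<open>Centres whose elements form a chain under taking powers\<close>

locale class_two_p_group = class_two_group +
  fixes p :: nat
  assumes prime_p: "Factorial_Ring.prime p"
    and finite_carrier: "finite (carrier G)"
    and order_prime_power: "\<exists>N. order G = p ^ N"
begin

lemma ord_prime_power:
  assumes "x \<in> carrier G"
  obtains m where "ord x = p ^ m"
proof -
  obtain N where "order G = p ^ N" using order_prime_power by blast
  then have "ord x dvd p ^ N" using ord_dvd_group_order[OF assms] by simp
  then show thesis using that divides_primepow_nat[OF prime_p] by blast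
qed

lemma prime_dvd_ord:
  assumes "x \<in> carrier G" "x \<noteq> \<one>"
  shows "p dvd ord x"
proof -
  obtain m where m: "ord x = p ^ m" using assms(1) by (rule ord_prime_power)
  have "ord x \<noteq> 1" using assms by (simp only: ord_eq_1 not_False_eq_True)
  then have "m \<noteq> 0" using m by (intro notI) simp
  then show ?thesis using m by simp
qed

lemma ord_pos: "x \<in> carrier G \<Longrightarrow> 0 < ord x"
  using ord_ge_1[OF finite_carrier] by (simp add: Suc_le_eq)

text \<open>
  The exponent \<open>ord x div p\<close> yields an element of order exactly \<open>p\<close> in the cyclic group of \<open>x\<close>.
\<close>

lemma exists_power_of_order_p:
  assumes "x \<in> carrier G" "x \<noteq> \<one>"
  shows "x [^] (ord x div p) \<noteq> \<one>" "(x [^] (ord x div p)) [^] p = \<one>"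
proof -
  have d: "p dvd ord x" using assms by (rule prime_dvd_ord)
  have "p \<noteq> 1" "p > 0" using prime_p not_prime_1 prime_gt_0_nat by auto
  then have "ord x div p < ord x" "0 < ord x div p"
    using ord_pos[OF assms(1)] d prime_gt_1_nat[OF prime_p] by (auto intro: div_less_dividend elim!: dvdE)
  then have "\<not> ord x dvd ord x div p" using nat_dvd_not_less by blast
  then show "x [^] (ord x div p) \<noteq> \<one>" using assms(1) pow_eq_id by blast
  show "(x [^] (ord x div p)) [^] p = \<one>" using assms(1) d by (simp add: nat_pow_pow)
qed

text \<open>
  The induction is on a common exponent \<open>p\<^sup>k\<close> of \<open>a\<close> and \<open>b\<close>.  If \<open>a\<^sup>p\<close> is a power of \<open>b\<^sup>p\<close>, then
  dividing \<open>a\<close> by the same power of \<open>b\<close> leaves an element of order dividing \<open>p\<close>, which by the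
  uniqueness hypothesis is again a power of \<open>b\<close>.
\<close>

lemma center_power_chain:
  assumes uniq: "\<And>d e. \<lbrakk>d \<in> center G; e \<in> center G; d [^] p = \<one>; e [^] p = \<one>; e \<noteq> \<one>\<rbrakk>
      \<Longrightarrow> \<exists>i::nat. d = e [^] i"
    and a: "a \<in> center G" and b: "b \<in> center G"
  shows "(\<exists>i::nat. a = b [^] i) \<or> (\<exists>i::nat. b = a [^] i)"
proof -
  have step: "\<exists>j::nat. a = b [^] j"
    if ab: "a \<in> center G" "b \<in> center G" "b \<noteq> \<one>" and eq: "a [^] p = (b [^] p) [^] i"
    for a b and i :: nat
  proof -
    let ?e = "b [^] (ord b div p)" and ?d = "a \<otimes> inv (b [^] i)"
    have "?d [^] p = \<one>"
      using ab eq by (simp add: mult_pow_central nat_pow_pow nat_pow_inv mult.commute)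
    then obtain j :: nat where "?d = ?e [^] j"
      using uniq[of ?d ?e] exists_power_of_order_p[of b] ab by auto
    then have "a \<otimes> inv (b [^] i) = b [^] (ord b div p * j)" using ab by (simp add: nat_pow_pow)
    then have "a = b [^] (ord b div p * j) \<otimes> b [^] i"
      using ab inv_solve_right'[of "b [^] (ord b div p * j)" a "b [^] i"] by simp
    then show ?thesis using ab by (auto simp: nat_pow_mult)
  qed
  have "(\<exists>i::nat. a = b [^] i) \<or> (\<exists>i::nat. b = a [^] i)"
    if "a \<in> center G" "b \<in> center G" "a [^] (p ^ k) = \<one>" "b [^] (p ^ k) = \<one>" for a b k
    using that
  proof (induction k arbitrary: a b)
    case 0
    then have "a = b [^] (0::nat)" by simp
    then show ?case by blast
  next
    case (Suc k)
    show ?case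
    proof (cases "a = \<one> \<or> b = \<one>")
      case True
      then have "a = b [^] (0::nat) \<or> b = a [^] (0::nat)" by simp
      then show ?thesis by blast
    next
      case False
      have "(a [^] p) [^] (p ^ k) = \<one>" "(b [^] p) [^] (p ^ k) = \<one>"
        using Suc.prems by (simp_all add: nat_pow_pow)
      then have "(\<exists>i::nat. a [^] p = (b [^] p) [^] i) \<or> (\<exists>i::nat. b [^] p = (a [^] p) [^] i)"
        using Suc.prems Suc.IH[of "a [^] p" "b [^] p"] by simp
      then show ?thesis using step[of a b] step[of b a] Suc.prems False by blast
    qed
  qed
  moreover obtain N where "order G = p ^ N" using order_prime_power by blast
  then have "a [^] (p ^ N) = \<one>" "b [^] (p ^ N) = \<one>"
    using a b pow_order_eq_1[of a] pow_order_eq_1[of b] by auto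
  ultimately show ?thesis using a b by blast
qed

text \<open>
  A commutator with as many powers as possible works: by the chain condition any other commutator is
  one of its powers or has it among its own powers, and the latter case contradicts maximality.
\<close>

lemma commutators_from_generator:
  assumes chain: "\<And>a b. \<lbrakk>a \<in> center G; b \<in> center G\<rbrakk>
      \<Longrightarrow> (\<exists>i::nat. a = b [^] i) \<or> (\<exists>i::nat. b = a [^] i)"
  obtains x y where "x \<in> carrier G" "y \<in> carrier G"
    "\<And>g g'. \<lbrakk>g \<in> carrier G; g' \<in> carrier G\<rbrakk> \<Longrightarrow> \<exists>i::nat. cm g g' = cm x y [^] i"
proof -
  define W where "W c = range (\<lambda>i::nat. c [^] i)" for c
  let ?S = "(\<lambda>(x, y). card (W (cm x y))) ` (carrier G \<times> carrier G)"
  have fin: "finite ?S" using finite_carrier by simp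
  have "Max ?S \<in> ?S" using fin by (intro Max_in) auto
  then obtain x y where xy: "x \<in> carrier G" "y \<in> carrier G" "card (W (cm x y)) = Max ?S"
    by auto
  have "\<exists>i::nat. cm g g' = cm x y [^] i" if g: "g \<in> carrier G" "g' \<in> carrier G" for g g'
  proof (rule ccontr)
    assume no: "\<nexists>i::nat. cm g g' = cm x y [^] i"
    then obtain i :: nat where i: "cm x y = cm g g' [^] i" using chain[of "cm g g'" "cm x y"] g xy by auto
    have "W (cm x y) \<subseteq> W (cm g g')" using g by (auto simp: W_def i nat_pow_pow)
    moreover have "cm g g' = cm g g' [^] (1::nat)" using g by simp
    then have "cm g g' \<in> W (cm g g')" unfolding W_def by blast
    moreover have "cm g g' \<notin> W (cm x y)" using no by (auto simp: W_def)
    moreover have "finite (W (cm g g'))"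
      by (rule finite_subset[OF _ finite_carrier]) (use g in \<open>auto simp: W_def\<close>)
    ultimately have "card (W (cm x y)) < card (W (cm g g'))" by (intro psubset_card_mono) auto
    moreover have "card (W (cm g g')) \<le> Max ?S" using fin g by (intro Max_ge) auto
    ultimately show False using xy by simp
  qed
  then show thesis using that xy by blast
qed

text \<open>
  With \<open>n\<close> the order of \<open>c = cm x y\<close>, both \<open>x\<^sup>n\<close> and \<open>y\<^sup>n\<close> are central, so one is a power of the other.
  Multiplying \<open>x\<close> by a suitable power of \<open>y\<close> (or exchanging the roles of the two) cancels \<open>x\<^sup>n\<close> and
  leaves the commutator \<open>c\<close> unchanged; only the term with exponent \<open>n choose 2\<close> remains.
\<close>

lemma element_with_small_power:
  assumes chain: "\<And>a b. \<lbrakk>a \<in> center G; b \<in> center G\<rbrakk>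
      \<Longrightarrow> (\<exists>i::nat. a = b [^] i) \<or> (\<exists>i::nat. b = a [^] i)"
  obtains x y and k :: nat where "x \<in> carrier G" "y \<in> carrier G"
    "\<forall>g\<in>carrier G. \<forall>g'\<in>carrier G. \<exists>i::nat. cm g g' = cm x y [^] i"
    "x [^] ord (cm x y) = inv (cm x y [^] (k * (ord (cm x y) choose 2)))"
proof -
  note result = that
  have adjust: thesis
    if xy: "x \<in> carrier G" "y \<in> carrier G"
      and gen: "\<And>g g'. \<lbrakk>g \<in> carrier G; g' \<in> carrier G\<rbrakk> \<Longrightarrow> \<exists>i::nat. cm g g' = cm x y [^] i"
      and i: "inv (x [^] ord (cm x y)) = (y [^] ord (cm x y)) [^] (i::nat)" for x y i
  proof -
    let ?n = "ord (cm x y)" and ?x = "x \<otimes> y [^] i"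
    have c: "cm ?x y = cm x y" using xy by (simp add: cm_mult_left cm_pow_left)
    have "?x [^] ?n = cm (y [^] i) x [^] (?n choose 2) \<otimes> (x [^] ?n \<otimes> (y [^] i) [^] ?n)"
      using xy by (intro mult_pow) auto
    also have "(y [^] i) [^] ?n = inv (x [^] ?n)"
      unfolding i using xy by (simp add: nat_pow_pow mult.commute)
    also have "cm (y [^] i) x = inv (cm x y [^] i)"
      using xy by (simp add: cm_pow_left cm_swap[of x y] nat_pow_inv)
    finally have "?x [^] ?n = inv (cm x y [^] (i * (?n choose 2)))"
      using xy by (simp add: nat_pow_inv nat_pow_pow)
    then show thesis using result[of ?x y i] xy gen c by simp
  qed
  obtain x y where xy: "x \<in> carrier G" "y \<in> carrier G"
    and gen: "\<And>g g'. \<lbrakk>g \<in> carrier G; g' \<in> carrier G\<rbrakk> \<Longrightarrow> \<exists>i::nat. cm g g' = cm x y [^] i"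
    using commutators_from_generator[OF chain] by blast
  let ?n = "ord (cm x y)"
  have central: "g [^] ?n \<in> center G" if g: "g \<in> carrier G" for g
    unfolding mem_center_iff
  proof (intro conjI ballI)
    fix g' assume g': "g' \<in> carrier G"
    obtain i :: nat where "cm g g' = cm x y [^] i" using gen[OF g g'] by blast
    then have "cm (g [^] ?n) g' = cm x y [^] (i * ?n)"
      using g g' xy by (simp add: cm_pow_left nat_pow_pow)
    also have "\<dots> = \<one>" using xy by (simp add: pow_eq_id)
    finally show "cm (g [^] ?n) g' = \<one>" .
  qed (use g in auto)
  from chain[of "inv (x [^] ?n)" "y [^] ?n"] central xy
  consider i :: nat where "inv (x [^] ?n) = (y [^] ?n) [^] i"
    | i :: nat where "y [^] ?n = inv (x [^] ?n) [^] i"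
    by auto
  then show thesis
  proof cases
    case 1
    then show thesis using adjust[OF xy gen] by blast
  next
    case (2 i)
    have yx: "cm y x = inv (cm x y)" using xy by (rule cm_swap)
    have "ord (cm y x) = ?n" using xy by (simp add: yx)
    moreover have "inv (y [^] ?n) = (x [^] ?n) [^] i" using 2 xy by (simp add: nat_pow_inv)
    moreover have "\<exists>i::nat. cm g g' = cm y x [^] i" if g: "g \<in> carrier G" "g' \<in> carrier G" for g g'
    proof -
      obtain i :: nat where "cm g' g = cm x y [^] i" using gen[OF g(2,1)] by blast
      then have "cm g g' = cm y x [^] i"
        using g xy by (simp add: yx nat_pow_inv cm_swap[of g' g])
      then show ?thesis by blast
    qed
    ultimately show thesis using adjust[OF xy(2,1)] by metis
  qed
qed

lemma prime_dvd_choose_two: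
  fixes n :: nat
  assumes "n = p ^ m" "p dvd n" "n \<noteq> 2"
  shows "p dvd (n choose 2)"
proof (cases "p = 2")
  case False
  have "odd p" using False prime_p primes_dvd_imp_eq two_is_prime_nat by metis
  then have "coprime p 2" by simp
  moreover have "even (n * (n - 1))" by (cases n) auto
  then have "2 * (n choose 2) = n * (n - 1)" by (simp add: choose_two)
  then have "p dvd 2 * (n choose 2)" using assms(2) by simp
  ultimately show ?thesis by (simp add: coprime_dvd_mult_right_iff)
next
  case True
  have "m \<noteq> 0" "m \<noteq> 1" using assms True by (auto intro!: gr0I)
  then obtain l where "m = Suc (Suc l)" by (metis One_nat_def nat.exhaust)
  then have "n * (n - 1) div 2 = 2 * (2 ^ l * (n - 1))" using assms True by simp
  then show ?thesis using True by (simp add: choose_two)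
qed

text \<open>
  For \<open>n \<noteq> 2\<close> the prime \<open>p\<close> divides \<open>n choose 2\<close>, so that \<open>x\<^sup>n\<close> is a \<open>p\<close>-th power of a central element and
  \<open>x\<^bsup>n/p\<^esup>\<close> can be corrected to an element \<open>w\<close> of order \<open>p\<close>.  For \<open>n = 2\<close> the argument is a search for a
  noncentral square root of \<open>c\<close> among \<open>x\<close>, \<open>y\<close>, \<open>x y\<close>, powers of \<open>y\<close> and their products with \<open>x\<close>.
\<close>

lemma noninner_from_power_chain:
  assumes chain: "\<And>a b. \<lbrakk>a \<in> center G; b \<in> center G\<rbrakk>
      \<Longrightarrow> (\<exists>i::nat. a = b [^] i) \<or> (\<exists>i::nat. b = a [^] i)"
    and nonabelian: "center G \<noteq> carrier G"
  shows "\<exists>\<phi>\<in>carrier (AutoGroup G). \<phi> \<notin> inner_auto G \<and> group.ord (AutoGroup G) \<phi> = p \<and>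
           (\<forall>z\<in>center G. \<phi> z = z)"
proof -
  obtain x y and k :: nat where xy: "x \<in> carrier G" "y \<in> carrier G"
    and gen: "\<forall>g\<in>carrier G. \<forall>g'\<in>carrier G. \<exists>i::nat. cm g g' = cm x y [^] i"
    and xn: "x [^] ord (cm x y) = inv (cm x y [^] (k * (ord (cm x y) choose 2)))"
    using element_with_small_power[OF chain] by blast
  define c where "c = cm x y"
  define n where "n = ord c"
  have c: "c \<in> center G" "c \<in> carrier G" using xy by (auto simp: c_def)
  note gen = gen[folded c_def] and xn = xn[folded c_def, folded n_def]
  have c_nontrivial: "c \<noteq> \<one>"
  proof
    assume "c = \<one>"
    then have "cm g g' = \<one>" if "g \<in> carrier G" "g' \<in> carrier G" for g g' using gen that by fastforce
    then have "center G = carrier G" using mem_center_iff by blast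
    then show False using nonabelian by contradiction
  qed
  have n: "p dvd n" using prime_dvd_ord c c_nontrivial by (simp add: n_def)
  have x_noncentral: "x \<notin> center G" and y_noncentral: "y \<notin> center G"
    using xy c_nontrivial by (auto simp: c_def)
  show ?thesis
  proof (cases "n = 2")
    case False
    obtain m where "n = p ^ m" using ord_prime_power[OF c(2)] n_def by blast
    then have pC: "p dvd (n choose 2)" using prime_dvd_choose_two n False by blast
    define z where "z = c [^] (k * ((n choose 2) div p))"
    define w where "w = x [^] (n div p) \<otimes> z"
    define t where "t = c [^] (n div p)"
    have z: "z \<in> center G" and w: "w \<in> carrier G" and t: "t \<in> center G"
      using c xy by (auto simp: z_def w_def t_def)
    have t_nontrivial: "t \<noteq> \<one>" and tp: "t [^] p = \<one>"
      using exists_power_of_order_p[OF c(2) c_nontrivial] by (simp_all add: t_def n_def)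
    have "z [^] p = c [^] (k * (n choose 2))"
      using c pC by (simp add: z_def nat_pow_pow mult.assoc)
    then have wp: "w [^] p = \<one>"
      using xy z n c xn by (simp add: w_def mult_pow_central nat_pow_pow)
    have cm_w: "cm w g = cm x g [^] (n div p)" if "g \<in> carrier G" for g
      using that xy z by (simp add: w_def cm_mult_left cm_pow_left)
    have w_noncentral: "w \<notin> center G"
      using cm_w[OF xy(2)] t_nontrivial xy by (auto simp: t_def c_def)
    have hom: "(\<lambda>g. cm x g) \<in> hom G G" using xy by (auto simp: hom_def cm_mult_right)
    obtain \<phi> where \<phi>: "\<phi> \<in> carrier (AutoGroup G)" "group.ord (AutoGroup G) \<phi> = p"
        "\<And>z. z \<in> center G \<Longrightarrow> \<phi> z = z"
        "\<And>g i. \<lbrakk>g \<in> carrier G; cm x g = c [^] (i::nat)\<rbrakk> \<Longrightarrow> \<phi> g = g \<otimes> (w [^] i \<otimes> t [^] (i choose 2))"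
    proof (rule twisted_translation_automorphism[OF prime_p group_axioms hom c(2)])
      show "\<exists>i::nat. cm x g = c [^] i" if "g \<in> carrier G" for g using gen xy(1) that by blast
      show "p dvd ord c" using n by (simp add: n_def)
      show "w \<noteq> \<one>" using w_noncentral by auto
      show "t [^] (ord c choose 2) = \<one>"
        using pC t tp by (auto simp: n_def[symmetric] nat_pow_pow[symmetric])
      show "cm w g = t [^] i" if "g \<in> carrier G" "cm x g = c [^] i" for g and i :: nat
        using that cm_w c by (simp add: t_def nat_pow_pow mult.commute)
      show "cm x w = \<one>" using xy z by (simp add: w_def cm_mult_right cm_pow_right)
      show "cm x z = \<one>" if "z \<in> center G" for z using xy that by simp
      show "y \<in> carrier G" "cm x y = c" using xy by (auto simp: c_def)
    qed (use w wp t tp in auto)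
    have "\<phi> y = y \<otimes> w" using \<phi>(4)[of y 1] xy c w t by (simp add: c_def numeral_2_eq_2)
    then have "\<phi> \<notin> inner_auto G" using xy w w_noncentral by (intro noninnerI) auto
    then show ?thesis using \<phi> by blast
  next
    case True
    then have p2: "p = 2" using n prime_p by (metis primes_dvd_imp_eq two_is_prime_nat)
    have cc: "c \<otimes> c = \<one>" using pow_ord_eq_1[OF c(2)] True c by (simp add: n_def[symmetric] numeral_2_eq_2)
    have powers: "c [^] i = \<one> \<or> c [^] i = c" for i :: nat
      by (induction i) (use c cc in auto)
    have cm_c: "cm g g' = \<one> \<or> cm g g' = c" if "g \<in> carrier G" "g' \<in> carrier G" for g g'
      using gen that powers by metis
    have inv_c: "inv c = c" using cc c by (simp add: inv_equality)
    have xx: "x \<otimes> x = \<one> \<or> x \<otimes> x = c"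
      using xn True xy powers[of k] inv_c by (auto simp: numeral_2_eq_2)
    obtain w where "w \<in> carrier G" "w \<notin> center G" "w \<otimes> w = c"
    proof (cases "x \<otimes> x = c")
      case False
      then have xx: "x \<otimes> x = \<one>" using xx by blast
      have yy: "y \<otimes> y \<in> center G"
        unfolding mem_center_iff using xy cm_c[of y] cc by (auto simp: cm_mult_left) (metis l_one one_closed)
      from chain[OF yy c(1)] show thesis
      proof (elim disjE exE)
        fix i :: nat assume "y \<otimes> y = c [^] i"
        then consider "y \<otimes> y = c" | "y \<otimes> y = \<one>" using powers[of i] by auto
        then show thesis
        proof cases
          case 1
          then show thesis using that xy y_noncentral by blast
        next
          case 2
          have "(x \<otimes> y) \<otimes> (x \<otimes> y) = c"
            using mult_pow[of x y 2] xy 2 xx inv_c cm_swap[of x y] by (simp add: numeral_2_eq_2 c_def)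
          moreover have "cm (x \<otimes> y) y = c" using xy c by (simp add: cm_mult_left c_def)
          then have "x \<otimes> y \<notin> center G" using xy c_nontrivial by auto
          ultimately show thesis using that xy by blast
        qed
      next
        fix k :: nat assume k: "c = (y \<otimes> y) [^] k"
        let ?s = "y [^] k"
        have "y \<otimes> y = y [^] (2::nat)" using xy by (simp add: numeral_2_eq_2)
        then have "c = y [^] (k + k)" using k xy by (simp add: nat_pow_pow mult_2)
        then have ss: "?s \<otimes> ?s = c" using xy by (simp add: nat_pow_mult)
        show thesis
        proof (cases "?s \<in> center G")
          case False
          then show thesis using that ss xy by blast
        next
          case True
          have "(x \<otimes> ?s) \<otimes> (x \<otimes> ?s) = c"
            using mult_pow_central[of x ?s 2] True xy xx ss by (simp add: numeral_2_eq_2 c)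
          moreover have "cm (x \<otimes> ?s) y = c" using xy True c by (simp add: cm_mult_left c_def)
          then have "x \<otimes> ?s \<notin> center G" using xy c_nontrivial by auto
          moreover have "x \<otimes> ?s \<in> carrier G" using xy by simp
          ultimately show thesis by (intro that[of "x \<otimes> ?s"])
        qed
      qed
    qed (use that xy x_noncentral in blast)
    from involution_by_square_root[OF c(1) c_nontrivial cc cm_c this]
    show ?thesis unfolding p2 by metis
  qed
qed

end

section \<open>Centres with independent elements of order p\<close>

lemma card_eq_fibre_times_image:
  fixes k :: nat
  assumes "finite A" "\<And>a. a \<in> A \<Longrightarrow> card {a' \<in> A. f a' = f a} = k"
  shows "card A = k * card (f ` A)"
proof -
  have "card A = (\<Sum>y\<in>f ` A. card {x \<in> A. f x = y})"
    using sum.image_gen[OF assms(1), of "\<lambda>_. 1::nat" f] by simp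
  also have "\<dots> = (\<Sum>y\<in>f ` A. k)" using assms(2) by (intro sum.cong) auto
  finally show ?thesis by simp
qed

context class_two_p_group begin

lemma inv_is_power:
  assumes "x \<in> carrier G"
  obtains k :: nat where "inv x = x [^] Suc k"
proof
  have "x [^] Suc (2 * ord x - 2) \<otimes> x = x [^] Suc (Suc (2 * ord x - 2))" by simp
  also have "Suc (Suc (2 * ord x - 2)) = ord x * 2" using ord_pos[OF assms] by simp
  also have "x [^] (ord x * 2) = \<one>" using assms by (simp add: pow_eq_id)
  finally show "inv x = x [^] Suc (2 * ord x - 2)" using assms by (intro inv_equality) auto
qed

lemma subgroup_of_closed:
  assumes sub: "H \<subseteq> carrier G" and ne: "H \<noteq> {}"
    and mult: "\<And>x y. \<lbrakk>x \<in> H; y \<in> H\<rbrakk> \<Longrightarrow> x \<otimes> y \<in> H"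
  shows "subgroup H G"
proof -
  have inv: "inv x \<in> H" if "x \<in> H" for x
  proof -
    have x: "x \<in> carrier G" using sub that by blast
    have "x [^] Suc k \<in> H" for k :: nat
      by (induction k) (use that mult x in auto)
    then show ?thesis using inv_is_power[OF x] by metis
  qed
  show ?thesis by (rule subgroupI[OF sub ne inv mult])
qed

lemma inverse_mod_p:
  assumes "\<not> p dvd i"
  obtains k l :: nat where "i * k = p * l + 1"
proof -
  have "coprime p i" using prime_p assms by (rule prime_imp_coprime)
  then have "gcd i p = 1" by (simp add: gcd.commute coprime_iff_gcd_eq_1)
  moreover have "i \<noteq> 0" using assms by (intro notI) simp
  ultimately show thesis using bezout_nat[of i p] that by auto
qed

lemma power_coprime:
  assumes "z \<in> carrier G" "z [^] p = \<one>" "z [^] (i::nat) \<noteq> \<one>"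
  obtains k :: nat where "z [^] (i * k) = z"
proof -
  have "\<not> p dvd i" using assms by (auto simp: nat_pow_pow[symmetric])
  then obtain k l where "i * k = p * l + 1" by (rule inverse_mod_p)
  then have "z [^] (i * k) = z" using assms by (simp add: nat_pow_mult[symmetric] nat_pow_pow[symmetric])
  then show thesis by (rule that)
qed

text \<open>
  The map \<open>b \<mapsto> cm a b\<close> is a homomorphism from \<open>B\<close> onto the group of order \<open>p\<close> generated by \<open>z\<close>, and
  its fibres are the cosets of its kernel.
\<close>

lemma p_times_card_kernel:
  assumes z: "z \<in> carrier G" "z [^] p = \<one>" "z \<noteq> \<one>" and a: "a \<in> carrier G"
    and B: "subgroup B G" and pow: "\<And>b. b \<in> B \<Longrightarrow> \<exists>i::nat. cm a b = z [^] i"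
    and b0: "b0 \<in> B" "cm a b0 \<noteq> \<one>"
  shows "p * card {b \<in> B. cm a b = \<one>} = card B"
proof -
  interpret B: subgroup B G by (rule B)
  have Bc: "b \<in> carrier G" if "b \<in> B" for b using B.subset that by blast
  let ?K = "{b \<in> B. cm a b = \<one>}"
  have fibre: "card {b' \<in> B. cm a b' = cm a b} = card ?K" if b: "b \<in> B" for b
  proof -
    have "{b' \<in> B. cm a b' = cm a b} = (\<lambda>k. b \<otimes> k) ` ?K"
    proof (intro equalityI subsetI)
      fix b' assume b': "b' \<in> {b' \<in> B. cm a b' = cm a b}"
      have "cm a (inv b \<otimes> b') = cm a (inv b) \<otimes> cm a b"
        using b b' a Bc by (simp add: cm_mult_right)
      also have "\<dots> = cm a (inv b \<otimes> b)" using b a Bc by (simp only: cm_mult_right inv_closed)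
      also have "\<dots> = \<one>" using b a Bc by simp
      finally have "inv b \<otimes> b' \<in> ?K" using b b' by simp
      moreover have "b' = b \<otimes> (inv b \<otimes> b')" using b b' Bc by (simp flip: m_assoc)
      ultimately show "b' \<in> (\<lambda>k. b \<otimes> k) ` ?K" by blast
    qed (use a b Bc in \<open>auto simp: cm_mult_right\<close>)
    moreover have "inj_on (\<lambda>k. b \<otimes> k) ?K" using b Bc by (auto intro!: inj_onI)
    ultimately show ?thesis by (simp add: card_image)
  qed
  have "(\<lambda>b. cm a b) ` B = (\<lambda>i. z [^] i) ` {..<p}"
  proof (intro equalityI subsetI)
    fix v assume "v \<in> (\<lambda>b. cm a b) ` B"
    then obtain i :: nat where "v = z [^] i" using pow by blast
    also have "z [^] i = z [^] (p * (i div p) + i mod p)" by simp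
    also have "\<dots> = z [^] (i mod p)"
      using z by (simp only: nat_pow_mult[symmetric] nat_pow_pow[symmetric]) simp
    finally show "v \<in> (\<lambda>i. z [^] i) ` {..<p}" using prime_gt_0_nat[OF prime_p] by auto
  next
    fix v assume "v \<in> (\<lambda>i. z [^] i) ` {..<p}"
    then obtain j :: nat where v: "v = z [^] j" by blast
    obtain i :: nat where i: "cm a b0 = z [^] i" using pow b0 by blast
    obtain k :: nat where k: "z [^] (i * k) = z" using power_coprime[of z i] z b0 i by metis
    have "b0 [^] n \<in> B" for n :: nat by (induction n) (use b0 in auto)
    moreover have "cm a (b0 [^] (k * j)) = (z [^] (i * k)) [^] j"
      using a b0 Bc z by (simp add: cm_pow_right i nat_pow_pow mult.assoc)
    then have "cm a (b0 [^] (k * j)) = v" by (simp add: k v)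
    ultimately show "v \<in> (\<lambda>b. cm a b) ` B" by blast
  qed
  moreover have "inj_on (\<lambda>i::nat. z [^] i) {..<p}"
  proof (rule inj_onI)
    fix i j :: nat assume ij: "i \<in> {..<p}" "j \<in> {..<p}" "z [^] i = z [^] j"
    have "ord z dvd p" "ord z \<noteq> 1" using z pow_eq_id ord_eq_1 by blast+
    then have "ord z = p" using prime_p by (auto simp: prime_nat_iff)
    then show "i = j" using pow_eq_imp_mod_ord_eq[OF z(1) ij(3)] ij by simp
  qed
  ultimately have "card ((\<lambda>b. cm a b) ` B) = p" by (simp add: card_image)
  moreover have "finite B" using B.subset finite_carrier finite_subset by blast
  ultimately show ?thesis using card_eq_fibre_times_image[of B "\<lambda>b. cm a b" "card ?K"] fibre by simp
qed

text \<open>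
  An element \<open>a\<close> of \<open>A\<close> commutes with all of \<open>B\<close> or with exactly one \<open>p\<close>-th of it.  The equation sums
  this over \<open>A\<close> and is arranged so that no subtraction of natural numbers occurs.
\<close>

lemma count_commuting_pairs:
  assumes z: "z \<in> carrier G" "z [^] p = \<one>" "z \<noteq> \<one>"
    and A: "subgroup A G" and B: "subgroup B G"
    and pow: "\<And>a b. \<lbrakk>a \<in> A; b \<in> B\<rbrakk> \<Longrightarrow> \<exists>i::nat. cm a b = z [^] i"
  shows "p * card {(a, b). a \<in> A \<and> b \<in> B \<and> cm a b = \<one>} + card {a \<in> A. \<forall>b\<in>B. cm a b = \<one>} * card B
    = p * (card {a \<in> A. \<forall>b\<in>B. cm a b = \<one>} * card B) + card A * card B"
proof -
  let ?K = "{a \<in> A. \<forall>b\<in>B. cm a b = \<one>}"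
  have AG: "A \<subseteq> carrier G" and BG: "B \<subseteq> carrier G" using A B by (auto dest: subgroup.subset)
  have fin: "finite A" "finite B" using AG BG finite_carrier finite_subset by blast+
  have "{(a, b). a \<in> A \<and> b \<in> B \<and> cm a b = \<one>} = (SIGMA a:A. {b \<in> B. cm a b = \<one>})" by auto
  then have "p * card {(a, b). a \<in> A \<and> b \<in> B \<and> cm a b = \<one>} = (\<Sum>a\<in>A. p * card {b \<in> B. cm a b = \<one>})"
    using fin by (simp add: sum_distrib_left)
  also have "\<dots> = (\<Sum>a\<in>?K. p * card {b \<in> B. cm a b = \<one>}) + (\<Sum>a\<in>A - ?K. p * card {b \<in> B. cm a b = \<one>})"
    using fin by (subst sum.subset_diff[of ?K A]) auto
  also have "(\<Sum>a\<in>?K. p * card {b \<in> B. cm a b = \<one>}) = (\<Sum>a\<in>?K. p * card B)"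
  proof (rule sum.cong)
    fix a assume "a \<in> ?K"
    then have "{b \<in> B. cm a b = \<one>} = B" by auto
    then show "p * card {b \<in> B. cm a b = \<one>} = p * card B" by simp
  qed simp
  also have "(\<Sum>a\<in>A - ?K. p * card {b \<in> B. cm a b = \<one>}) = (\<Sum>a\<in>A - ?K. card B)"
  proof (rule sum.cong)
    fix a assume a: "a \<in> A - ?K"
    then obtain b0 where "b0 \<in> B" "cm a b0 \<noteq> \<one>" by blast
    then show "p * card {b \<in> B. cm a b = \<one>} = card B"
      using a AG by (intro p_times_card_kernel[OF z _ B pow]) auto
  qed simp
  finally have "p * card {(a, b). a \<in> A \<and> b \<in> B \<and> cm a b = \<one>}
      = p * (card ?K * card B) + card (A - ?K) * card B"
    by simp
  moreover have "card (A - ?K) + card ?K = card A"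
    using fin card_mono[of A ?K] by (simp add: card_Diff_subset)
  then have "card A * card B = card (A - ?K) * card B + card ?K * card B"
    by (metis add_mult_distrib)
  ultimately show ?thesis by linarith
qed

definition commutators_in_powers :: "'a \<Rightarrow> 'a set" where
  "commutators_in_powers z = {u \<in> carrier G. \<forall>g\<in>carrier G. \<exists>i::nat. cm g u = z [^] i}"

definition centralizer_of_commutators_in_powers :: "'a \<Rightarrow> 'a set" where
  "centralizer_of_commutators_in_powers z = {g \<in> carrier G. \<forall>u\<in>commutators_in_powers z. cm g u = \<one>}"

lemma subgroup_commutators_in_powers:
  assumes "z \<in> carrier G"
  shows "subgroup (commutators_in_powers z) G"
proof (rule subgroup_of_closed)
  have "cm g \<one> = z [^] (0::nat)" if "g \<in> carrier G" for g using that by simp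
  then have "\<one> \<in> commutators_in_powers z" unfolding commutators_in_powers_def by blast
  then show "commutators_in_powers z \<noteq> {}" by blast
next
  fix u v assume uv: "u \<in> commutators_in_powers z" "v \<in> commutators_in_powers z"
  have "\<exists>i::nat. cm g (u \<otimes> v) = z [^] i" if g: "g \<in> carrier G" for g
  proof -
    obtain i j :: nat where "cm g u = z [^] i" "cm g v = z [^] j"
      using uv g unfolding commutators_in_powers_def by blast
    then have "cm g (u \<otimes> v) = z [^] (i + j)"
      using uv g assms by (simp add: commutators_in_powers_def cm_mult_right nat_pow_mult)
    then show ?thesis by blast
  qed
  then show "u \<otimes> v \<in> commutators_in_powers z" using uv by (simp add: commutators_in_powers_def)
qed (auto simp: commutators_in_powers_def)

text \<open>
  Counting the commuting pairs by their first and by their second component gives two equations with the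
  same left-hand count; their difference is \<open>(p - 1)\<close> times the claim.
\<close>

lemma card_commutators_in_powers:
  assumes z: "z \<in> carrier G" "z [^] p = \<one>" "z \<noteq> \<one>"
  shows "card (commutators_in_powers z) * card (centralizer_of_commutators_in_powers z)
    = card (carrier G) * card (center G)"
proof -
  let ?U = "commutators_in_powers z" and ?K = "centralizer_of_commutators_in_powers z" and ?C = "carrier G"
  let ?S = "{(a, b). a \<in> ?C \<and> b \<in> ?U \<and> cm a b = \<one>}"
    and ?T = "{(b, a). b \<in> ?U \<and> a \<in> ?C \<and> cm b a = \<one>}"
  have U: "subgroup ?U G" using z(1) by (rule subgroup_commutators_in_powers)
  have UG: "?U \<subseteq> ?C" by (auto simp: commutators_in_powers_def)
  have swap: "cm b a = \<one> \<longleftrightarrow> cm a b = \<one>" if "a \<in> ?C" "b \<in> ?C" for a b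
    using that cm_eq_one_iff by metis
  have "bij_betw prod.swap ?S ?T"
    by (rule bij_betw_byWitness[where f' = prod.swap]) (use UG swap in auto)
  then have ST: "card ?S = card ?T" by (rule bij_betw_same_card)
  have "center G \<subseteq> ?U"
  proof
    fix x assume x: "x \<in> center G"
    then have "cm g x = z [^] (0::nat)" if "g \<in> ?C" for g using that by simp
    then show "x \<in> ?U" using x unfolding commutators_in_powers_def by blast
  qed
  then have Z: "{b \<in> ?U. \<forall>a\<in>?C. cm b a = \<one>} = center G"
    using UG mem_center_iff by blast
  have K: "{a \<in> ?C. \<forall>b\<in>?U. cm a b = \<one>} = ?K" by (simp add: centralizer_of_commutators_in_powers_def)
  have pow: "\<exists>i::nat. cm a b = z [^] i" if "a \<in> ?C" "b \<in> ?U" for a b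
    using that unfolding commutators_in_powers_def by blast
  have pow': "\<exists>i::nat. cm b a = z [^] i" if b: "b \<in> ?U" and a: "a \<in> ?C" for a b
  proof -
    have bG: "b \<in> ?C" using b UG by blast
    obtain i :: nat where i: "cm a b = z [^] i" using pow[OF a b] by blast
    obtain k :: nat where "inv (cm a b) = cm a b [^] Suc k"
      using inv_is_power[OF cm_closed[OF a bG]] by blast
    then have "cm b a = cm a b [^] Suc k" using cm_swap[OF a bG] by simp
    then have "cm b a = z [^] (i * Suc k)" using z by (simp only: i nat_pow_pow)
    then show ?thesis by blast
  qed
  have "p * card ?S + card ?K * card ?U = p * (card ?K * card ?U) + card ?C * card ?U"
    using count_commuting_pairs[OF z subgroup_self U pow] unfolding K .
  moreover have "p * card ?S + card (center G) * card ?C = p * (card (center G) * card ?C) + card ?U * card ?C"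
    using count_commuting_pairs[OF z U subgroup_self pow'] unfolding Z ST .
  moreover define x' y' w' v' where "x' = int (card ?K * card ?U)" and "y' = int (card (center G) * card ?C)"
    and "w' = int (card ?C * card ?U)" and "v' = int (p * card ?S)"
  ultimately have "v' + x' = int p * x' + w'" "v' + y' = int p * y' + w'"
    by (simp_all flip: of_nat_add of_nat_mult add: mult.commute)
  then have "(int p - 1) * (x' - y') = 0" by (simp add: algebra_simps)
  then have "x' = y'" using prime_gt_1_nat[OF prime_p] by simp
  then show ?thesis by (simp add: x'_def y'_def mult.commute flip: of_nat_mult)
qed

definition p_powers_mod_center :: "'a set" where
  "p_powers_mod_center = (\<lambda>(g, z). g [^] p \<otimes> z) ` (carrier G \<times> center G)"

definition p_torsion_mod_center :: "'a set" where
  "p_torsion_mod_center = {g \<in> carrier G. g [^] p \<in> center G}"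

lemma p_power_mult_mod_center:
  assumes "g \<in> carrier G" "h \<in> carrier G"
  obtains s where "s \<in> center G" "(g \<otimes> h) [^] p = (g [^] p \<otimes> h [^] p) \<otimes> s"
proof
  show "cm h g [^] (p choose 2) \<in> center G" using assms by simp
  then show "(g \<otimes> h) [^] p = (g [^] p \<otimes> h [^] p) \<otimes> cm h g [^] (p choose 2)"
    using assms mult_pow[of g h p] center_commutes[of "cm h g [^] (p choose 2)"] by simp
qed

text \<open>
  Modulo the centre the \<open>p\<close>-th power map is a homomorphism, with kernel \<open>E/Z\<close> and image \<open>P/Z\<close>.  The
  count is done on \<open>G \<times> Z\<close>, where every fibre of \<open>(g, z) \<mapsto> g\<^sup>p z\<close> projects bijectively onto a coset of
  \<open>E\<close>.
\<close>

lemma card_p_powers_mod_center: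
  "card (carrier G) * card (center G) = card p_torsion_mod_center * card p_powers_mod_center"
proof -
  let ?f = "\<lambda>(g, z). g [^] p \<otimes> z" and ?A = "carrier G \<times> center G" and ?E = p_torsion_mod_center
  have fin: "finite ?A" using finite_carrier subgroup.subset[OF subgroup_center] finite_subset by blast
  have fibre: "card {a' \<in> ?A. ?f a' = ?f a} = card ?E" if aA: "a \<in> ?A" for a
  proof -
    obtain g z where a: "a = (g, z)" "g \<in> carrier G" "z \<in> center G" using aA by blast
    let ?F = "{a' \<in> ?A. ?f a' = ?f a}"
    have inj: "inj_on fst ?F"
    proof (rule inj_onI)
      fix u v assume uv: "u \<in> ?F" "v \<in> ?F" "fst u = fst v"
      then have "fst u [^] p \<otimes> snd u = fst u [^] p \<otimes> snd v" by (simp add: case_prod_beta)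
      moreover have "fst u \<in> carrier G" "snd u \<in> carrier G" "snd v \<in> carrier G" using uv by auto
      ultimately have "snd u = snd v" by simp
      with uv(3) show "u = v" by (simp add: prod_eq_iff)
    qed
    have img: "fst ` ?F = (\<lambda>e. g \<otimes> e) ` ?E"
    proof (intro equalityI subsetI)
      fix h assume "h \<in> fst ` ?F"
      then obtain y where h: "h \<in> carrier G" "y \<in> center G" "h [^] p \<otimes> y = g [^] p \<otimes> z"
        using a by auto
      obtain s where s: "s \<in> center G"
        "(inv g \<otimes> h) [^] p = (inv g [^] p \<otimes> h [^] p) \<otimes> s"
        using p_power_mult_mod_center[of "inv g" h] a h by blast
      have "h [^] p = (g [^] p \<otimes> z) \<otimes> inv y"
        using h a inv_solve_right[of "h [^] p" "g [^] p \<otimes> z" y] by simp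
      then have "inv g [^] p \<otimes> h [^] p = (inv g [^] p \<otimes> g [^] p) \<otimes> (z \<otimes> inv y)"
        using a h by (simp add: m_assoc)
      also have "\<dots> = z \<otimes> inv y" using a h by (simp add: nat_pow_inv)
      finally have "inv g \<otimes> h \<in> ?E" using s a h by (simp add: p_torsion_mod_center_def)
      moreover have "h = g \<otimes> (inv g \<otimes> h)" using a h by (simp flip: m_assoc)
      ultimately show "h \<in> (\<lambda>e. g \<otimes> e) ` ?E" by blast
    next
      fix h assume "h \<in> (\<lambda>e. g \<otimes> e) ` ?E"
      then obtain e where e: "e \<in> carrier G" "e [^] p \<in> center G" "h = g \<otimes> e"
        by (auto simp: p_torsion_mod_center_def)
      obtain s where s: "s \<in> center G" "(g \<otimes> e) [^] p = (g [^] p \<otimes> e [^] p) \<otimes> s"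
        using p_power_mult_mod_center[of g e] a e by blast
      let ?r = "e [^] p \<otimes> s"
      have r: "?r \<in> center G" using e s by simp
      have "h [^] p \<otimes> (inv ?r \<otimes> z) = g [^] p \<otimes> (?r \<otimes> (inv ?r \<otimes> z))"
        using a e s by (simp add: m_assoc)
      also have "?r \<otimes> (inv ?r \<otimes> z) = z" using r a by (simp flip: m_assoc)
      finally have "(h, inv ?r \<otimes> z) \<in> ?F" using a e r by simp
      then show "h \<in> fst ` ?F" by force
    qed
    have "inj_on (\<lambda>e. g \<otimes> e) ?E" using a by (auto intro!: inj_onI simp: p_torsion_mod_center_def)
    then have "card (fst ` ?F) = card ?E" unfolding img by (rule card_image)
    then show ?thesis using card_image[OF inj] by simp
  qed
  have "card ?A = card ?E * card (?f ` ?A)" by (rule card_eq_fibre_times_image[OF fin fibre])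
  then show ?thesis by (simp add: p_powers_mod_center_def card_cartesian_product)
qed

lemma subgroup_p_powers_mod_center: "subgroup p_powers_mod_center G"
proof (rule subgroup_of_closed)
  show "p_powers_mod_center \<subseteq> carrier G" "p_powers_mod_center \<noteq> {}"
    by (auto simp: p_powers_mod_center_def)
next
  fix x y assume "x \<in> p_powers_mod_center" "y \<in> p_powers_mod_center"
  then obtain g z h v where x: "g \<in> carrier G" "z \<in> center G" "x = g [^] p \<otimes> z"
    and y: "h \<in> carrier G" "v \<in> center G" "y = h [^] p \<otimes> v"
    by (auto simp: p_powers_mod_center_def)
  obtain s where s: "s \<in> center G" "(g \<otimes> h) [^] p = (g [^] p \<otimes> h [^] p) \<otimes> s"
    using p_power_mult_mod_center[OF x(1) y(1)] by blast
  have gh: "g [^] p \<otimes> h [^] p = (g \<otimes> h) [^] p \<otimes> inv s"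
    using s x y inv_solve_right[of "g [^] p \<otimes> h [^] p" "(g \<otimes> h) [^] p" s] by simp
  have "x \<otimes> y = g [^] p \<otimes> (z \<otimes> (h [^] p \<otimes> v))" using x y by (simp add: m_assoc)
  also have "z \<otimes> (h [^] p \<otimes> v) = h [^] p \<otimes> (z \<otimes> v)"
    using center_pull[of z "h [^] p" v] x y by simp
  also have "g [^] p \<otimes> \<dots> = (g \<otimes> h) [^] p \<otimes> (inv s \<otimes> (z \<otimes> v))"
    using gh x y s by (simp flip: m_assoc)
  finally have "x \<otimes> y = (\<lambda>(g, z). g [^] p \<otimes> z) (g \<otimes> h, inv s \<otimes> (z \<otimes> v))" by simp
  then show "x \<otimes> y \<in> p_powers_mod_center"
    unfolding p_powers_mod_center_def using x y s by blast
qed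

lemma p_powers_mod_center_mem:
  "z \<in> center G \<Longrightarrow> z \<in> p_powers_mod_center"
  "g \<in> carrier G \<Longrightarrow> g [^] p \<in> p_powers_mod_center"
proof -
  assume "z \<in> center G"
  then have "(\<one>, z) \<in> carrier G \<times> center G" "z = (\<lambda>(g, z). g [^] p \<otimes> z) (\<one>, z)" by auto
  then show "z \<in> p_powers_mod_center" unfolding p_powers_mod_center_def by blast
next
  assume "g \<in> carrier G"
  then have "(g, \<one>) \<in> carrier G \<times> center G" "g [^] p = (\<lambda>(g, z). g [^] p \<otimes> z) (g, \<one>)" by auto
  then show "g [^] p \<in> p_powers_mod_center" unfolding p_powers_mod_center_def by blast
qed

text \<open>
  A subgroup \<open>N\<close> that is maximal among those containing \<open>P\<close> but not \<open>g\<close> works.  It is normal because it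
  contains the centre.  If \<open>h \<notin> N\<close>, maximality puts \<open>g\<close> into \<open>N\<langle>h\<rangle>\<close>, and as \<open>G/N\<close> has exponent \<open>p\<close>, the
  relation \<open>g \<equiv> h\<^sup>k\<close> can be inverted.
\<close>

lemma normal_with_cyclic_quotient:
  assumes g: "g \<in> carrier G" "g \<notin> p_powers_mod_center"
  obtains N where "N \<lhd> G" "p_powers_mod_center \<subseteq> N" "g \<notin> N"
    "\<And>h. h \<in> carrier G \<Longrightarrow> \<exists>i::nat. N #> h = (N #> g) [^]\<^bsub>G Mod N\<^esub> i"
proof -
  let ?P = p_powers_mod_center
  let ?C = "{N. subgroup N G \<and> ?P \<subseteq> N \<and> g \<notin> N}"
  have "?C \<subseteq> Pow (carrier G)" using subgroup.subset by blast
  then have fin: "finite ?C" by (rule finite_subset) (simp add: finite_carrier)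
  have ne: "?C \<noteq> {}" using subgroup_p_powers_mod_center g by blast
  obtain N where "N \<in> ?C" and max: "\<forall>M\<in>?C. N \<subseteq> M \<longrightarrow> N = M"
    using finite_has_maximal[OF fin ne] by blast
  then have N: "subgroup N G" "?P \<subseteq> N" "g \<notin> N" by auto
  interpret N: subgroup N G by (rule N)
  have NC: "n \<in> carrier G" if "n \<in> N" for n using that N.subset by blast
  have ZN: "z \<in> N" if "z \<in> center G" for z using that N p_powers_mod_center_mem by blast
  have "x \<otimes> n \<otimes> inv x \<in> N" if "x \<in> carrier G" "n \<in> N" for x n
  proof -
    have "x \<otimes> n \<otimes> inv x = cm x n \<otimes> n"
      using that NC by (simp add: cm_def m_assoc)
    then show ?thesis using that NC ZN by simp
  qed
  then have normal: "N \<lhd> G" using N by (simp add: normal_inv_iff)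
  interpret N: normal N G by (rule normal)
  interpret Q: group "G Mod N" by (rule N.factorgroup_is_group)
  interpret q: group_hom G "G Mod N" "\<lambda>x. N #> x"
    using N.r_coset_hom_Mod by unfold_locales
  have qN: "N #> n = \<one>\<^bsub>G Mod N\<^esub>" if "n \<in> N" for n
    using that NC coset_join2[of n N] N by simp
  have qp: "(N #> h) [^]\<^bsub>G Mod N\<^esub> p = \<one>\<^bsub>G Mod N\<^esub>" if "h \<in> carrier G" for h
    using that qN[of "h [^] p"] N p_powers_mod_center_mem(2)[of h] q.hom_nat_pow[of h p] by auto
  have "\<exists>i::nat. N #> h = (N #> g) [^]\<^bsub>G Mod N\<^esub> i" if h: "h \<in> carrier G" for h
  proof (cases "h \<in> N")
    case True
    then have "N #> h = (N #> g) [^]\<^bsub>G Mod N\<^esub> (0::nat)" using qN by simp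
    then show ?thesis by blast
  next
    case False
    define M where "M = {n \<otimes> h [^] k | n (k::nat). n \<in> N}"
    have "subgroup M G"
    proof (rule subgroup_of_closed)
      show "M \<subseteq> carrier G" using h NC by (auto simp: M_def)
      show "M \<noteq> {}" using N.one_closed unfolding M_def by blast
    next
      fix x y assume "x \<in> M" "y \<in> M"
      then obtain n m and k l :: nat where x: "n \<in> N" "x = n \<otimes> h [^] k" and y: "m \<in> N" "y = m \<otimes> h [^] l"
        by (auto simp: M_def)
      have "x \<otimes> y = n \<otimes> ((h [^] k \<otimes> m) \<otimes> h [^] l)" using x y NC h by (simp add: m_assoc)
      also have "h [^] k \<otimes> m = cm (h [^] k) m \<otimes> (m \<otimes> h [^] k)"
        using y NC h by (intro mult_swap_cm) auto
      also have "n \<otimes> (\<dots> \<otimes> h [^] l) = (n \<otimes> (cm (h [^] k) m \<otimes> m)) \<otimes> h [^] (k + l)"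
        using x y NC h by (simp add: m_assoc nat_pow_mult)
      finally have "x \<otimes> y = (n \<otimes> (cm (h [^] k) m \<otimes> m)) \<otimes> h [^] (k + l)" .
      moreover have "n \<otimes> (cm (h [^] k) m \<otimes> m) \<in> N" using x y h NC ZN by simp
      ultimately show "x \<otimes> y \<in> M" unfolding M_def by blast
    qed
    moreover have NM: "N \<subseteq> M"
    proof
      fix n assume "n \<in> N"
      moreover have "n = n \<otimes> h [^] (0::nat)" using NC \<open>n \<in> N\<close> by simp
      ultimately show "n \<in> M" unfolding M_def by blast
    qed
    moreover have "h = \<one> \<otimes> h [^] (1::nat)" using h by simp
    then have "h \<in> M" unfolding M_def using N.one_closed by blast
    then have "N \<noteq> M" using False by blast
    ultimately have "g \<in> M" using max N(2) by blast
    then obtain n and k :: nat where nk: "n \<in> N" "g = n \<otimes> h [^] k" by (auto simp: M_def)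
    then have "N #> g = (N #> n) \<otimes>\<^bsub>G Mod N\<^esub> (N #> h [^] k)"
      using h NC q.hom_mult[of n "h [^] k"] by simp
    also have "\<dots> = N #> h [^] k"
      unfolding qN[OF nk(1)] by (rule Q.l_one) (use h q.hom_closed in blast)
    also have "\<dots> = (N #> h) [^]\<^bsub>G Mod N\<^esub> k" using h by (rule q.hom_nat_pow)
    finally have qg: "N #> g = (N #> h) [^]\<^bsub>G Mod N\<^esub> k" .
    have "\<not> p dvd k"
    proof
      assume "p dvd k"
      then obtain l where "k = l * p" by (metis dvdE mult.commute)
      then have "h [^] k = (h [^] l) [^] p" using h by (simp add: nat_pow_pow)
      then have "h [^] k \<in> N" using h N p_powers_mod_center_mem(2)[of "h [^] l"] by auto
      then show False using nk N by simp
    qed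
    then obtain i l where il: "k * i = p * l + 1" by (rule inverse_mod_p)
    have qh: "N #> h \<in> carrier (G Mod N)" using h by simp
    have "(N #> g) [^]\<^bsub>G Mod N\<^esub> i = (N #> h) [^]\<^bsub>G Mod N\<^esub> (p * l + 1)"
      using qh by (simp only: qg Q.nat_pow_pow il)
    also have "\<dots> = (((N #> h) [^]\<^bsub>G Mod N\<^esub> p) [^]\<^bsub>G Mod N\<^esub> l) \<otimes>\<^bsub>G Mod N\<^esub> (N #> h) [^]\<^bsub>G Mod N\<^esub> (1::nat)"
      using qh by (simp only: Q.nat_pow_mult Q.nat_pow_pow Q.nat_pow_closed)
    also have "\<dots> = N #> h" using qh h by (simp only: qp Q.nat_pow_one Q.nat_pow_eone Q.l_one)
    finally show ?thesis by metis
  qed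
  then show thesis using that normal N by blast
qed

lemma central_automorphism:
  assumes g: "g \<in> carrier G" "g \<notin> p_powers_mod_center"
    and z: "z \<in> center G" "z [^] p = \<one>" "z \<noteq> \<one>"
  obtains \<phi> where "\<phi> \<in> carrier (AutoGroup G)" "group.ord (AutoGroup G) \<phi> = p"
    "\<forall>x\<in>center G. \<phi> x = x" "\<phi> g = g \<otimes> z"
    "\<forall>h\<in>carrier G. \<exists>i::nat. \<phi> h = h \<otimes> z [^] i"
proof -
  obtain N where N: "N \<lhd> G" "p_powers_mod_center \<subseteq> N" "g \<notin> N"
    and cyc: "\<And>h. h \<in> carrier G \<Longrightarrow> \<exists>i::nat. N #> h = (N #> g) [^]\<^bsub>G Mod N\<^esub> i"
    using normal_with_cyclic_quotient[OF g] by metis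
  interpret N: normal N G by (rule N)
  interpret Q: group "G Mod N" by (rule N.factorgroup_is_group)
  interpret q: group_hom G "G Mod N" "\<lambda>x. N #> x"
    using N.r_coset_hom_Mod by unfold_locales
  have Nsub: "subgroup N G" by unfold_locales
  have qN: "N #> n = \<one>\<^bsub>G Mod N\<^esub>" if "n \<in> N" for n
    using that N.subset coset_join2[of n N] Nsub by auto
  have qZ: "N #> x = \<one>\<^bsub>G Mod N\<^esub>" if "x \<in> center G" for x
    using that qN N p_powers_mod_center_mem by blast
  have "(N #> g) [^]\<^bsub>G Mod N\<^esub> p = \<one>\<^bsub>G Mod N\<^esub>"
    using g qN[of "g [^] p"] N p_powers_mod_center_mem(2)[of g] q.hom_nat_pow[of g p] by auto
  moreover have "N #> g \<noteq> \<one>\<^bsub>G Mod N\<^esub>"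
    using N(3) g rcos_self[OF g(1) Nsub] by auto
  moreover have qg: "N #> g \<in> carrier (G Mod N)" using g by simp
  ultimately have "Q.ord (N #> g) dvd p" "Q.ord (N #> g) \<noteq> 1"
    using Q.pow_eq_id Q.ord_eq_1 by blast+
  then have ord: "Q.ord (N #> g) = p" using prime_p by (auto simp: prime_nat_iff)
  obtain \<phi> where \<phi>: "\<phi> \<in> carrier (AutoGroup G)" "group.ord (AutoGroup G) \<phi> = p"
      "\<And>x. x \<in> center G \<Longrightarrow> \<phi> x = x"
      "\<And>h i. \<lbrakk>h \<in> carrier G; N #> h = (N #> g) [^]\<^bsub>G Mod N\<^esub> (i::nat)\<rbrakk>
        \<Longrightarrow> \<phi> h = h \<otimes> (z [^] i \<otimes> \<one> [^] (i choose 2))"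
    by (rule twisted_translation_automorphism[OF prime_p Q.is_group N.r_coset_hom_Mod qg cyc,
          where w = z and t = \<one> and a = g]) (use ord z g qZ in auto)
  have "\<phi> h = h \<otimes> z [^] i" if "h \<in> carrier G" "N #> h = (N #> g) [^]\<^bsub>G Mod N\<^esub> i" for h and i :: nat
    using \<phi>(4)[OF that] z by simp
  moreover from this[OF g(1) Q.nat_pow_eone[OF qg, symmetric]]
  have "\<phi> g = g \<otimes> z" using z by simp
  ultimately show thesis using that[of \<phi>] \<phi> cyc by metis
qed

text \<open>
  In the sequence of iterated \<open>p\<close>-th powers of a noncentral element, the last noncentral member works.
\<close>

lemma p_torsion_mod_center_noncentral:
  assumes "center G \<noteq> carrier G"
  obtains x where "x \<in> p_torsion_mod_center" "x \<notin> center G"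
proof -
  obtain x where x: "x \<in> carrier G" "x \<notin> center G" using assms by auto
  obtain M where "order G = p ^ M" using order_prime_power by blast
  then have ex: "x [^] (p ^ M) \<in> center G" using pow_order_eq_1[OF x(1)] by simp
  define k where "k = (LEAST k. x [^] (p ^ k) \<in> center G)"
  have k: "x [^] (p ^ k) \<in> center G" unfolding k_def using ex by (rule LeastI)
  have "k \<noteq> 0" using k x by (intro notI) simp
  then obtain j where j: "k = Suc j" using not0_implies_Suc by blast
  have "x [^] (p ^ j) \<notin> center G" 
    using not_less_Least[of j "\<lambda>k. x [^] (p ^ k) \<in> center G"] j by (simp flip: k_def)
  moreover have "(x [^] (p ^ j)) [^] p \<in> center G"
    using k x by (simp add: j nat_pow_pow mult.commute)
  ultimately show thesis using that[of "x [^] (p ^ j)"] x by (simp add: p_torsion_mod_center_def)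
qed

text \<open>
  If every central automorphism were inner, the two counts would make \<open>U = E\<close> both for \<open>z = d\<close> and for
  \<open>z = e\<close>, and a commutator with an element of \<open>E\<close> would be a power of \<open>d\<close> and of \<open>e\<close> at once.
\<close>

lemma noninner_from_independent_elements:
  assumes d: "d \<in> center G" "d [^] p = \<one>" and e: "e \<in> center G" "e [^] p = \<one>" "e \<noteq> \<one>"
    and indep: "\<nexists>i::nat. d = e [^] i"
    and nonabelian: "center G \<noteq> carrier G"
  shows "\<exists>\<phi>\<in>carrier (AutoGroup G). \<phi> \<notin> inner_auto G \<and> group.ord (AutoGroup G) \<phi> = p \<and>
           (\<forall>z\<in>center G. \<phi> z = z)"
proof (rule ccontr)
  assume none: "\<not> ?thesis"
  let ?E = p_torsion_mod_center and ?P = p_powers_mod_center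
  have EU: "?E \<subseteq> commutators_in_powers z"
    if z: "z \<in> center G" "z [^] p = \<one>" "z \<noteq> \<one>" for z
  proof -
    let ?U = "commutators_in_powers z" and ?K = "centralizer_of_commutators_in_powers z"
    have KP: "?K \<subseteq> ?P"
    proof
      fix g assume gK: "g \<in> ?K"
      then have g: "g \<in> carrier G" by (simp add: centralizer_of_commutators_in_powers_def)
      show "g \<in> ?P"
      proof (rule ccontr)
        assume "g \<notin> ?P"
        then obtain \<phi> where \<phi>: "\<phi> \<in> carrier (AutoGroup G)" "group.ord (AutoGroup G) \<phi> = p"
            "\<forall>x\<in>center G. \<phi> x = x" "\<phi> g = g \<otimes> z"
            "\<forall>h\<in>carrier G. \<exists>i::nat. \<phi> h = h \<otimes> z [^] i"
          using central_automorphism[OF g _ z] by metis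
        then have "\<phi> \<in> inner_auto G" using none by blast
        then obtain u where u: "u \<in> carrier G" "\<And>h. h \<in> carrier G \<Longrightarrow> \<phi> h = h \<otimes> cm h u"
          using inner_auto_by_cm[of \<phi>] by metis
        have "\<exists>i::nat. cm h u = z [^] i" if h: "h \<in> carrier G" for h
        proof -
          obtain i :: nat where "\<phi> h = h \<otimes> z [^] i" using \<phi>(5) h by blast
          then have "cm h u = z [^] i" using u h z by simp
          then show ?thesis by blast
        qed
        then have "u \<in> ?U" using u by (simp add: commutators_in_powers_def)
        then have "cm g u = \<one>" using gK by (simp add: centralizer_of_commutators_in_powers_def)
        then show False using u(2)[OF g] \<phi>(4) g z by simp
      qed
    qed
    have UE: "?U \<subseteq> ?E"
    proof
      fix u assume "u \<in> ?U"
      then have u: "u \<in> carrier G" "\<And>g. g \<in> carrier G \<Longrightarrow> \<exists>i::nat. cm g u = z [^] i"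
        by (auto simp: commutators_in_powers_def)
      have "cm (u [^] p) g = \<one>" if g: "g \<in> carrier G" for g
      proof -
        obtain i :: nat where "cm g u = z [^] i" using u(2)[OF g] by blast
        then have "cm g (u [^] p) = z [^] (p * i)"
          using u g z by (simp add: cm_pow_right nat_pow_pow mult.commute)
        also have "\<dots> = (z [^] p) [^] i" using z(1) by (simp only: nat_pow_pow center_closed)
        finally show ?thesis using cm_swap[of g "u [^] p"] u g z by simp
      qed
      then have "u [^] p \<in> center G" using u mem_center_iff by blast
      then show "u \<in> ?E" using u by (simp add: p_torsion_mod_center_def)
    qed
    have fin: "finite ?E" "finite ?P"
      using finite_subset[OF _ finite_carrier] subgroup.subset[OF subgroup_p_powers_mod_center]
      by (auto simp: p_torsion_mod_center_def)
    have "card ?E * card ?P = card ?U * card ?K"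
      using card_commutators_in_powers[of z] card_p_powers_mod_center z by simp
    also have "\<dots> \<le> card ?U * card ?P" using KP fin by (intro mult_left_mono card_mono) auto
    finally have "card ?E * card ?P \<le> card ?U * card ?P" .
    moreover have "0 < card ?P" using p_powers_mod_center_mem(1)[of \<one>] fin card_gt_0_iff by auto
    ultimately have "card ?E \<le> card ?U" by simp
    then have "?U = ?E" using UE fin by (intro card_seteq) auto
    then show ?thesis by simp
  qed
  have "d \<noteq> \<one>"
  proof
    assume "d = \<one>"
    then have "d = e [^] (0::nat)" by simp
    then show False using indep by blast
  qed
  obtain u where uE: "u \<in> ?E" and u: "u \<notin> center G"
    using p_torsion_mod_center_noncentral[OF nonabelian] by blast
  have uG: "u \<in> carrier G" using uE by (simp add: p_torsion_mod_center_def)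
  then obtain g where g: "g \<in> carrier G" "cm u g \<noteq> \<one>" using u mem_center_iff by blast
  then have gu: "cm g u \<noteq> \<one>" using uG cm_swap[of g u] by auto
  obtain i j :: nat where ij: "cm g u = d [^] i" "cm g u = e [^] j"
    using EU[OF d \<open>d \<noteq> \<one>\<close>] EU[OF e] uE g(1) unfolding commutators_in_powers_def by blast
  then obtain k :: nat where "d [^] (i * k) = d" using power_coprime[of d i] d gu by (metis center_closed)
  moreover have "d [^] (i * k) = e [^] (j * k)"
    using ij d e by (metis center_closed nat_pow_pow)
  ultimately show False using indep by metis
qed

theorem exists_noninner_fixing_center:
  assumes nonabelian: "center G \<noteq> carrier G"
  shows "\<exists>\<phi>\<in>carrier (AutoGroup G). \<phi> \<notin> inner_auto G \<and> group.ord (AutoGroup G) \<phi> = p \<and>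
           (\<forall>z\<in>center G. \<phi> z = z)"
proof (cases "\<exists>d e. d \<in> center G \<and> e \<in> center G \<and> d [^] p = \<one> \<and> e [^] p = \<one> \<and> e \<noteq> \<one> \<and>
    (\<nexists>i::nat. d = e [^] i)")
  case True
  then show ?thesis using noninner_from_independent_elements nonabelian by blast
next
  case False
  then have "(\<exists>i::nat. a = b [^] i) \<or> (\<exists>i::nat. b = a [^] i)"
    if "a \<in> center G" "b \<in> center G" for a b
    using center_power_chain[OF _ that] by blast
  then show ?thesis using noninner_from_power_chain nonabelian by blast
qed

end

section \<open>Nilpotency class two\<close>

lemma (in group) class_two_groupI:
  assumes "has_nilpotency_class G 2"
  shows "class_two_group G"
proof (unfold_locales)
  fix x y assume xy: "x \<in> carrier G" "y \<in> carrier G"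
  let ?c = "x \<otimes> y \<otimes> inv x \<otimes> inv y"
  have c: "?c \<in> carrier G" using xy by simp
  have triv: "lower_central G (Suc (Suc 0)) = {\<one>}"
    using assms by (simp add: has_nilpotency_class_def numeral_2_eq_2)
  have c1: "?c \<in> lower_central G (Suc 0)"
    using xy by (auto simp: commutator_subgroup_def intro!: generate.incl)
  have "?c \<otimes> g = g \<otimes> ?c" if g: "g \<in> carrier G" for g
  proof -
    have "?c \<otimes> g \<otimes> inv ?c \<otimes> inv g \<in> lower_central G (Suc (Suc 0))"
      unfolding lower_central.simps(2)[of G "Suc 0"] commutator_subgroup_def
      using c1 g by (intro generate.incl) blast
    then have "?c \<otimes> g \<otimes> inv ?c \<otimes> inv g = \<one>" by (simp only: triv singleton_iff)
    then have "?c \<otimes> g \<otimes> inv ?c = \<one> \<otimes> g"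
      using c g inv_solve_right'[of \<one> "?c \<otimes> g \<otimes> inv ?c" g] by (simp del: l_one)
    then have "?c \<otimes> g \<otimes> inv ?c = g" using g by (simp only: l_one)
    then show ?thesis using c g inv_solve_right'[of g "?c \<otimes> g" ?c] by (simp only: m_closed)
  qed
  then show "?c \<in> center G" using c unfolding center_def by blast
qed

lemma (in group) Omega1_center_subset: "Omega1 p (G\<lparr>carrier := center G\<rparr>) \<subseteq> center G"
proof -
  let ?Z = "G\<lparr>carrier := center G\<rparr>"
  interpret Z: group ?Z by (rule subgroup.subgroup_is_group[OF subgroup_center is_group])
  have "generate ?Z {x \<in> carrier ?Z. x [^]\<^bsub>?Z\<^esub> p = \<one>\<^bsub>?Z\<^esub>} \<subseteq> carrier ?Z"
    by (rule Z.generate_incl) blast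
  then show ?thesis by (simp add: Omega1_def)
qed

theorem mainTheorem1:
  fixes G :: "('a, 'b) monoid_scheme" and p :: nat
  assumes "Factorial_Ring.prime p"
    and "group G"
    and "finite (carrier G)"
    and "\<exists>n. order G = p ^ n"
    and "\<not> comm_group G"
    and "has_nilpotency_class G 2"
  shows "\<exists>\<phi> \<in> carrier (AutoGroup G).
           \<phi> \<notin> inner_auto G \<and> group.ord (AutoGroup G) \<phi> = p \<and>
           ((\<forall>x \<in> frattini G. \<phi> x = x) \<or>
            (\<forall>x \<in> Omega1 p (G\<lparr>carrier := center G\<rparr>). \<phi> x = x))"
proof -
  interpret group G by fact
  interpret class_two_group G using assms(6) by (rule class_two_groupI)
  interpret class_two_p_group G p using assms(1,3,4) by unfold_locales
  have "center G \<noteq> carrier G"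
  proof
    assume "center G = carrier G"
    then have "x \<otimes>\<^bsub>G\<^esub> y = y \<otimes>\<^bsub>G\<^esub> x" if "x \<in> carrier G" "y \<in> carrier G" for x y
      using that center_commutes[of y x] by simp
    then have "comm_group G" by (rule group_comm_groupI)
    then show False using assms(5) by contradiction
  qed
  then show ?thesis using exists_noninner_fixing_center Omega1_center_subset by blast
qed

end
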